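(* Suppose that $(G,d,\delta)$ is a groupoid weak $\delta$-structure. Then for any $x \in Ob(G)$ the triple $(\alpha^{-1}(x), \tilde d, \delta)$ is a dilatation structure, where $\tilde d(g,h)=d(gh^{-1})$ is restricted to $\alpha^{-1}(x)\times\alpha^{-1}(x)$ and where the dilatations are given by $$\delta^{h}_{\varepsilon}\, g \, = \, \delta_{\varepsilon}(g h^{-1})\, h , \qquad g,h\in\alpha^{-1}(x),\ \varepsilon\in\Gamma .$$
   Context: **Groupoids.** A groupoid $G$ is a set of arrows with source map $\alpha$ and target map $\omega$; the product $gh$ is defined iff $\omega(h)=\alpha(g)$, and then $\omega(gh)=\omega(g)$, $\alpha(gh)=\alpha(h)$. Objects are identified with identity arrows: $Ob(G)=\{g^{-1}g : g\in G\}\subset G$, $\alpha(g)=g^{-1}g$, $\omega(g)=gg^{-1}$. Put $G\times_\alpha G=\{(g,h)\in G^2: \alpha(g)=\alpha(h)\}$ and $dif(g,h)=gh^{-1}$ for $(g,h)\in G\times_\alpha G$. **Norms.** A norm on $G$ is a function $d:G\to[0,+\infty)$ with $d(g)=0$ iff $g\in Ob(G)$; $d(gh)\le d(g)+d(h)$ when $gh$ is defined; $d(g^{-1})=d(g)$. It is separable if whenever a net $(a_\varepsilon)$ of arrows satisfies $\alpha(a_\varepsilon)=x$, $\omega(a_\varepsilon)=y$ for all $\varepsilon$ and $\lim d(a_\varepsilon)=0$, then $x=y$. On $Ob(G)$ let $d_{ob}(x,y)=\inf\{d(g):\alpha(g)=x,\omega(g)=y\}\in[0,+\infty]$; bounded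 subsets of $Ob(G)$ are taken with respect to $d_{ob}$. **$\alpha$-double groupoid.** $G\times_\alpha G$ is a groupoid with composition $(g,h)(h,l)=(g,l)$, inverse $(g,h)^{-1}=(h,g)$, source $\tilde\alpha(g,h)=(h,h)$, target $\tilde\omega(g,h)=(g,g)$, objects the pairs $(g,g)$, and norm $\tilde d(g,h)=d(gh^{-1})$. Restricted to $\alpha^{-1}(x)\times\alpha^{-1}(x)$, $\tilde d$ is a distance. **The group $\Gamma$.** $\Gamma$ is a commutative group with neutral element $e$ and a morphism $|\cdot|:\Gamma\to(0,+\infty)$ to the multiplicative group, taking arbitrarily small values; $\varepsilon\to0$ means $|\varepsilon|\to0$. **Uniform convergence on bounded sets.** A net of functions $f_\varepsilon$ ($\varepsilon\in\Gamma$) from (a subset of) $G\times_\alpha G$ to $G$ converges to $f$ uniformly on bounded sets if $\alpha(f_\varepsilon(h,g))=\alpha(f(h,g))$ and for all $\lambda,\mu>0$ there is $\varepsilon(\lambda,\mu)>0$ such that $d(f_\varepsilon(h,g)\,f(h,g)^{-1})\le\mu$ for all $|\varepsilon|\le\varepsilon(\lambda,\mu)$ and all $(h,g)$ with $d(h),d(g)\le\lambda$. For real-valued functions on $G$ or $G\times_\alpha G$ the definition is the same with $|f_\varepsilon-f|\le\mu$. All maps are locally defined; identities and estimates concern arguments for which the expressions are defined. **Deformation.** A deformation of a normed groupoid $(G,d)$ with separable norm assigns to each $\varepsilon\in\Gamma$ a transformation $\delta_\varepsilon: dom(\varepsilon)\to im(\varepsilon)$ between subsets of $G$ containing $Ob(G)$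 such that: - A0. (i) $Ob(G)\subset dom(\varepsilon)$ and $dom(\varepsilon)=dom(\varepsilon)^{-1}$. (ii) Write $B_r(K)=\{g: d(g)\le r,\ \alpha(g)\in K\}$. For any bounded $K\subset Ob(G)$ there are $1<A<B$ such that for all $\varepsilon$ with $|\varepsilon|\le1$: $$B_{|\varepsilon|}(K)\subset\delta_\varepsilon(B_A(K))\subset dom(\varepsilon^{-1})\cap\alpha^{-1}(K)\subset\delta_\varepsilon(B_B(K))\subset\delta_\varepsilon(dom(\varepsilon)\cap\alpha^{-1}(K)).$$ (iii) For any bounded $K\subset Ob(G)$ there are $R>0$ and $\varepsilon_0\in(0,1]$ such that for $|\varepsilon|\le\varepsilon_0$ and $g,h\in B_R(K)$ with $\alpha(g)=\alpha(h)$ we have $dif(\delta_\varepsilon g,\delta_\varepsilon h)\in dom(\varepsilon^{-1})$. - A1. $\alpha\,\delta_\varepsilon=\alpha$, $\delta_\varepsilon\delta_\mu=\delta_{\varepsilon\mu}$, $(\delta_\varepsilon)^{-1}=\delta_{\varepsilon^{-1}}$, $\delta_e=id$. - A2. $\delta_\varepsilon(x)=x$ for all $x\in Ob(G)$, $\varepsilon\in\Gamma$, and $d\,\delta_\varepsilon\to0$ uniformly on bounded sets as $\varepsilon\to0$. **Groupoid weak $\delta$-structure.** A deformation $(G,d,\delta)$ of a normed groupoid with separable norm such that: - A3. For a neighbourhood $U$ of $Ob(G)$ in $G$ there is a function $\tilde d_0:(G\times_\alpha G)\cap U^2\to\mathbb{R}$ which is the limit $$\lim_{\varepsilon\to0}\frac{1}{|\varepsilon|}\,d\,dif(\delta_\varepsilon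 g,\delta_\varepsilon h)=\tilde d_0(g,h)$$ uniformly on bounded sets. Moreover convergence with respect to $\tilde d_0$ is the same as convergence with respect to $\tilde d$; in particular $\tilde d_0(g,h)=0$ implies $g=h$. - A4weak. There is a deformation $\bar\delta$ of the normed groupoid $(G\times_\alpha G,\tilde d_0)$ such that for every $\varepsilon\in\Gamma$ the transformations $$\tilde\delta_{\mu,\varepsilon}(g,h)=\Big(\delta_{\mu^{-1}}\big(\delta_\varepsilon(\delta_\mu(g)(\delta_\mu(h))^{-1})\,\delta_\mu(h)\big),\,h\Big)$$ converge to $\bar\delta_\varepsilon$ uniformly on bounded sets as $\mu\to0$. **Dilatation structure.** A triple $(X,d,\delta)$ with $(X,d)$ a metric space and $\delta$ a function $(\varepsilon,x,y)\mapsto\delta^x_\varepsilon y\in X$, defined for $\varepsilon\in\Gamma$, $x\in X$, $y\in dom(\varepsilon,x)\subset X$ (domains are not tracked explicitly), such that: - A1. For each $x\in X$, $\varepsilon\mapsto\delta^x_\varepsilon$ is an action of $\Gamma$ by continuous transformations with continuous inverse fixing $x$ (so $\delta^x_\varepsilon x=x$, $\delta^x_e y=y$, $\delta^x_\varepsilon\delta^x_\mu y=\delta^x_{\varepsilon\mu}y$). - A2. $\delta$ is continuous, and extends continuously to $\bar\Gamma\times X\times X$, $\bar\Gamma=\Gamma\cup\{0\}$, by $\delta(0,x,y)=x$ (neighbourhoods of $0$ in $\bar\Gamma$ contain some $\{0\}\cup\{|\varepsilon|<r\}$; $\Gamma$ is otherwise discrete); the limit $\lim_{\varepsilon\to0}\delta^x_\varepsilon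 y=x$ is uniform with respect to $x,y$ in bounded sets. - A3. There is $A>1$ such that for any $x$ there is a function $(u,v)\mapsto d^x(u,v)$ defined for $u,v$ in the closed ball $\bar B_d(x,A)$ such that $$\lim_{\varepsilon\to0}\ \sup\Big\{\Big|\tfrac{1}{|\varepsilon|}d(\delta^x_\varepsilon u,\delta^x_\varepsilon v)-d^x(u,v)\Big| : u,v\in\bar B_d(x,A)\Big\}=0$$ uniformly with respect to $x$ in bounded sets. Moreover the uniformity induced by $d^x$ is the same as that induced by $d$; in particular $d^x(u,v)=0$ implies $u=v$. - A4weak. For any $\mu\in\Gamma$ the limit $\lim_{\varepsilon\to0}\delta^x_{\varepsilon^{-1}}\,\delta^{\delta^x_\varepsilon u}_\mu\,\delta^x_\varepsilon v=\bar\delta^{x,u}_\mu v$ exists, uniformly with respect to $x,u,v$ in bounded sets.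
   Formalization: The transformations δ_ε of a deformation are assumed continuous (also under change of base object), without which continuity in A2 can fail; in A4weak the limit is required to be defined wherever the approximating maps of small parameter are, on bounded sets. *)

theory Defs
  imports "HOL-Analysis.Analysis" "HOL-Algebra.Group"
begin

section \<open>Groupoids\<close>

text \<open>A groupoid is its set of arrows with a partial product and an inverse; objects are identified
  with identity arrows, and source and target are derived. The product \<open>gmult G g h\<close> is meaningful
  only if \<open>gtgt G h = gsrc G g\<close>.\<close>

record 'g grpd =
  arrows :: "'g set"
  gmult :: "'g \<Rightarrow> 'g \<Rightarrow> 'g"
  ginv :: "'g \<Rightarrow> 'g"

definition gsrc :: "'g grpd \<Rightarrow> 'g \<Rightarrow> 'g" where
  "gsrc G g = gmult G (ginv G g) g"

definition gtgt :: "'g grpd \<Rightarrow> 'g \<Rightarrow> 'g" where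
  "gtgt G g = gmult G g (ginv G g)"

definition objects :: "'g grpd \<Rightarrow> 'g set" where
  "objects G = gsrc G ` arrows G"

definition fibre :: "'g grpd \<Rightarrow> 'g \<Rightarrow> 'g set" where
  "fibre G x = {g \<in> arrows G. gsrc G g = x}"

definition gdif :: "'g grpd \<Rightarrow> 'g \<Rightarrow> 'g \<Rightarrow> 'g" where
  "gdif G g h = gmult G g (ginv G h)"

locale groupoid =
  fixes G :: "'g grpd"
  assumes inv_closed: "g \<in> arrows G \<Longrightarrow> ginv G g \<in> arrows G"
    and src_inv: "g \<in> arrows G \<Longrightarrow> gsrc G (ginv G g) = gtgt G g"
    and tgt_inv: "g \<in> arrows G \<Longrightarrow> gtgt G (ginv G g) = gsrc G g"
    and mult_closed: "\<lbrakk>g \<in> arrows G; h \<in> arrows G; gtgt G h = gsrc G g\<rbrakk> \<Longrightarrow> gmult G g h \<in> arrows G"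
    and src_mult: "\<lbrakk>g \<in> arrows G; h \<in> arrows G; gtgt G h = gsrc G g\<rbrakk> \<Longrightarrow> gsrc G (gmult G g h) = gsrc G h"
    and tgt_mult: "\<lbrakk>g \<in> arrows G; h \<in> arrows G; gtgt G h = gsrc G g\<rbrakk> \<Longrightarrow> gtgt G (gmult G g h) = gtgt G g"
    and mult_assoc: "\<lbrakk>g \<in> arrows G; h \<in> arrows G; k \<in> arrows G; gtgt G h = gsrc G g; gtgt G k = gsrc G h\<rbrakk>
        \<Longrightarrow> gmult G (gmult G g h) k = gmult G g (gmult G h k)"
    and mult_src: "g \<in> arrows G \<Longrightarrow> gmult G g (gsrc G g) = g"
    and tgt_mult_self: "g \<in> arrows G \<Longrightarrow> gmult G (gtgt G g) g = g"

section \<open>Norms\<close>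

definition groupoid_norm :: "'g grpd \<Rightarrow> ('g \<Rightarrow> real) \<Rightarrow> bool" where
  "groupoid_norm G d \<longleftrightarrow>
     (\<forall>g\<in>arrows G. 0 \<le> d g \<and> (d g = 0 \<longleftrightarrow> g \<in> objects G) \<and> d (ginv G g) = d g) \<and>
     (\<forall>g\<in>arrows G. \<forall>h\<in>arrows G. gtgt G h = gsrc G g \<longrightarrow> d (gmult G g h) \<le> d g + d h)"

text \<open>Nets of arrows are represented by their eventuality filters: every net of arrows induces a
  proper filter on the arrows, and every proper filter arises in this way.\<close>

definition separable_norm :: "'g grpd \<Rightarrow> ('g \<Rightarrow> real) \<Rightarrow> bool" where
  "separable_norm G d \<longleftrightarrow>
     (\<forall>x\<in>objects G. \<forall>y\<in>objects G. \<forall>F.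
        F \<noteq> bot \<and> (\<forall>\<^sub>F a in F. a \<in> arrows G \<and> gsrc G a = x \<and> gtgt G a = y) \<and> (d \<longlongrightarrow> 0) F
        \<longrightarrow> x = y)"

definition sep_normed_groupoid :: "'g grpd \<Rightarrow> ('g \<Rightarrow> real) \<Rightarrow> bool" where
  "sep_normed_groupoid G d \<longleftrightarrow> groupoid G \<and> groupoid_norm G d \<and> separable_norm G d"

definition obj_dist :: "'g grpd \<Rightarrow> ('g \<Rightarrow> real) \<Rightarrow> 'g \<Rightarrow> 'g \<Rightarrow> ennreal" where
  "obj_dist G d x y = (INF g\<in>{g \<in> arrows G. gsrc G g = x \<and> gtgt G g = y}. ennreal (d g))"

definition bounded_objects :: "'g grpd \<Rightarrow> ('g \<Rightarrow> real) \<Rightarrow> 'g set \<Rightarrow> bool" where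
  "bounded_objects G d K \<longleftrightarrow>
     K \<subseteq> objects G \<and> (\<exists>r::real. \<forall>x\<in>K. \<forall>y\<in>K. obj_dist G d x y \<le> ennreal r)"

definition arrow_ball :: "'g grpd \<Rightarrow> ('g \<Rightarrow> real) \<Rightarrow> real \<Rightarrow> 'g set \<Rightarrow> 'g set" where
  "arrow_ball G d r K = {g \<in> arrows G. d g \<le> r \<and> gsrc G g \<in> K}"

section \<open>The double groupoid\<close>

text \<open>\<open>double_groupoid G U\<close> is the part of $G\times_\alpha G$ that lies in $U^2$; for
  \<open>U = arrows G\<close> it is all of $G\times_\alpha G$.\<close>

definition double_groupoid :: "'g grpd \<Rightarrow> 'g set \<Rightarrow> ('g \<times> 'g) grpd" where
  "double_groupoid G U =
     \<lparr>arrows = {(g, h). g \<in> arrows G \<and> h \<in> arrows G \<and> gsrc G g = gsrc G h \<and> g \<in> U \<and> h \<in> U},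
      gmult = (\<lambda>p q. (fst p, snd q)),
      ginv = (\<lambda>p. (snd p, fst p))\<rparr>"

lemma double_groupoid_src: "gsrc (double_groupoid G U) (g, h) = (h, h)"
  and double_groupoid_tgt: "gtgt (double_groupoid G U) (g, h) = (g, g)"
  by (simp_all add: double_groupoid_def gsrc_def gtgt_def)

section \<open>The group of scales\<close>

locale scale_group = comm_group \<Gamma> for \<Gamma> :: "('s, 'm) monoid_scheme" (structure) +
  fixes nu :: "'s \<Rightarrow> real"
  assumes nu_pos: "a \<in> carrier \<Gamma> \<Longrightarrow> 0 < nu a"
    and nu_mult: "\<lbrakk>a \<in> carrier \<Gamma>; b \<in> carrier \<Gamma>\<rbrakk> \<Longrightarrow> nu (a \<otimes> b) = nu a * nu b"
    and nu_small: "0 < r \<Longrightarrow> \<exists>a\<in>carrier \<Gamma>. nu a < r"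

text \<open>The error \<open>err \<epsilon> a\<close> tends to 0 as \<open>\<epsilon> \<rightarrow> 0\<close>, uniformly in \<open>a\<close>, where at scale \<open>\<epsilon>\<close> only the
  arguments \<open>a \<in> E \<epsilon>\<close> (those for which the error is defined) are taken into account.\<close>

definition unif_vanishing ::
  "('s, 'm) monoid_scheme \<Rightarrow> ('s \<Rightarrow> real) \<Rightarrow> ('s \<Rightarrow> 'a set) \<Rightarrow> ('s \<Rightarrow> 'a \<Rightarrow> real) \<Rightarrow> bool" where
  "unif_vanishing \<Gamma> nu E err \<longleftrightarrow>
     (\<forall>\<eta>>0. \<exists>r>0. \<forall>\<epsilon>\<in>carrier \<Gamma>. nu \<epsilon> \<le> r \<longrightarrow> (\<forall>a\<in>E \<epsilon>. err \<epsilon> a \<le> \<eta>))"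

section \<open>Deformations\<close>

text \<open>Continuity of a source-preserving partial transformation \<open>f\<close> with domain \<open>D\<close>. The arrows near
  \<open>a\<close> are the products \<open>p a q\<close> with \<open>p\<close> and \<open>q\<close> of small norm; since \<open>f (p a q)\<close> has the source of
  \<open>q\<close>, it is compared with \<open>f a\<close> after translation by the inverse of \<open>q\<close>.\<close>

definition continuous_transformation ::
  "'g grpd \<Rightarrow> ('g \<Rightarrow> real) \<Rightarrow> 'g set \<Rightarrow> ('g \<Rightarrow> 'g) \<Rightarrow> bool" where
  "continuous_transformation G d D f \<longleftrightarrow>
     (\<forall>a\<in>D. \<forall>\<eta>>0. \<exists>\<kappa>>0. \<forall>p\<in>arrows G. \<forall>q\<in>arrows G.
        gsrc G p = gtgt G a \<and> gtgt G q = gsrc G a \<and> d p \<le> \<kappa> \<and> d q \<le> \<kappa> \<and>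
        gmult G (gmult G p a) q \<in> D \<longrightarrow>
        d (gdif G (gdif G (f (gmult G (gmult G p a) q)) q) (f a)) \<le> \<eta>)"

definition deform_A0 :: "('s, 'm) monoid_scheme \<Rightarrow> ('s \<Rightarrow> real) \<Rightarrow> 'g grpd \<Rightarrow> ('g \<Rightarrow> real) \<Rightarrow>
    ('s \<Rightarrow> 'g set) \<Rightarrow> ('s \<Rightarrow> 'g \<Rightarrow> 'g) \<Rightarrow> bool" where
  "deform_A0 \<Gamma> nu G d dm \<delta> \<longleftrightarrow>
     (\<forall>\<epsilon>\<in>carrier \<Gamma>. objects G \<subseteq> dm \<epsilon> \<and> dm \<epsilon> = ginv G ` dm \<epsilon>) \<and>
     (\<forall>K. bounded_objects G d K \<longrightarrow>
        (\<exists>A B. 1 < A \<and> A < B \<and>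
          (\<forall>\<epsilon>\<in>carrier \<Gamma>. nu \<epsilon> \<le> 1 \<longrightarrow>
             arrow_ball G d B K \<subseteq> dm \<epsilon> \<and>
             arrow_ball G d (nu \<epsilon>) K \<subseteq> \<delta> \<epsilon> ` arrow_ball G d A K \<and>
             \<delta> \<epsilon> ` arrow_ball G d A K \<subseteq> dm (inv\<^bsub>\<Gamma>\<^esub> \<epsilon>) \<inter> {g \<in> arrows G. gsrc G g \<in> K} \<and>
             dm (inv\<^bsub>\<Gamma>\<^esub> \<epsilon>) \<inter> {g \<in> arrows G. gsrc G g \<in> K} \<subseteq> \<delta> \<epsilon> ` arrow_ball G d B K \<and>
             \<delta> \<epsilon> ` arrow_ball G d B K \<subseteq> \<delta> \<epsilon> ` (dm \<epsilon> \<inter> {g \<in> arrows G. gsrc G g \<in> K})))) \<and>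
     (\<forall>K. bounded_objects G d K \<longrightarrow>
        (\<exists>R \<epsilon>0. 0 < R \<and> 0 < \<epsilon>0 \<and> \<epsilon>0 \<le> 1 \<and>
          (\<forall>\<epsilon>\<in>carrier \<Gamma>. nu \<epsilon> \<le> \<epsilon>0 \<longrightarrow>
             (\<forall>g\<in>arrow_ball G d R K. \<forall>h\<in>arrow_ball G d R K. gsrc G g = gsrc G h \<longrightarrow>
                gdif G (\<delta> \<epsilon> g) (\<delta> \<epsilon> h) \<in> dm (inv\<^bsub>\<Gamma>\<^esub> \<epsilon>)))))"

text \<open>The equations of an action by partially defined maps: a composite is a restriction of the map
  of the product, and inverses have domain and image exchanged.\<close>

definition deform_A1 :: "('s, 'm) monoid_scheme \<Rightarrow> 'g grpd \<Rightarrow>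
    ('s \<Rightarrow> 'g set) \<Rightarrow> ('s \<Rightarrow> 'g \<Rightarrow> 'g) \<Rightarrow> bool" where
  "deform_A1 \<Gamma> G dm \<delta> \<longleftrightarrow>
     (\<forall>\<epsilon>\<in>carrier \<Gamma>. \<forall>g\<in>dm \<epsilon>. gsrc G (\<delta> \<epsilon> g) = gsrc G g) \<and>
     (\<forall>\<epsilon>\<in>carrier \<Gamma>. \<forall>\<mu>\<in>carrier \<Gamma>. \<forall>g\<in>dm \<mu>. \<delta> \<mu> g \<in> dm \<epsilon> \<longrightarrow>
        g \<in> dm (\<epsilon> \<otimes>\<^bsub>\<Gamma>\<^esub> \<mu>) \<and> \<delta> \<epsilon> (\<delta> \<mu> g) = \<delta> (\<epsilon> \<otimes>\<^bsub>\<Gamma>\<^esub> \<mu>) g) \<and>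
     (\<forall>\<epsilon>\<in>carrier \<Gamma>. dm (inv\<^bsub>\<Gamma>\<^esub> \<epsilon>) = \<delta> \<epsilon> ` dm \<epsilon> \<and> (\<forall>g\<in>dm \<epsilon>. \<delta> (inv\<^bsub>\<Gamma>\<^esub> \<epsilon>) (\<delta> \<epsilon> g) = g)) \<and>
     (\<forall>g\<in>dm \<one>\<^bsub>\<Gamma>\<^esub>. \<delta> \<one>\<^bsub>\<Gamma>\<^esub> g = g)"

definition deform_A2 :: "('s, 'm) monoid_scheme \<Rightarrow> ('s \<Rightarrow> real) \<Rightarrow> 'g grpd \<Rightarrow> ('g \<Rightarrow> real) \<Rightarrow>
    ('s \<Rightarrow> 'g set) \<Rightarrow> ('s \<Rightarrow> 'g \<Rightarrow> 'g) \<Rightarrow> bool" where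
  "deform_A2 \<Gamma> nu G d dm \<delta> \<longleftrightarrow>
     (\<forall>\<epsilon>\<in>carrier \<Gamma>. \<forall>x\<in>objects G. \<delta> \<epsilon> x = x) \<and>
     (\<forall>b>0. unif_vanishing \<Gamma> nu (\<lambda>\<epsilon>. {g \<in> dm \<epsilon>. d g \<le> b}) (\<lambda>\<epsilon> g. d (\<delta> \<epsilon> g)))"

text \<open>The transformations of a deformation are understood to be continuous. Without this, nothing
  relates the maps \<open>\<delta> \<epsilon>\<close> on the fibres over different objects at a fixed scale \<open>\<epsilon>\<close>.\<close>

definition deformation :: "('s, 'm) monoid_scheme \<Rightarrow> ('s \<Rightarrow> real) \<Rightarrow> 'g grpd \<Rightarrow> ('g \<Rightarrow> real) \<Rightarrow>
    ('s \<Rightarrow> 'g set) \<Rightarrow> ('s \<Rightarrow> 'g \<Rightarrow> 'g) \<Rightarrow> bool" where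
  "deformation \<Gamma> nu G d dm \<delta> \<longleftrightarrow>
     sep_normed_groupoid G d \<and>
     (\<forall>\<epsilon>\<in>carrier \<Gamma>. dm \<epsilon> \<subseteq> arrows G \<and> \<delta> \<epsilon> ` dm \<epsilon> \<subseteq> arrows G \<and>
        continuous_transformation G d (dm \<epsilon>) (\<delta> \<epsilon>)) \<and>
     deform_A0 \<Gamma> nu G d dm \<delta> \<and> deform_A1 \<Gamma> G dm \<delta> \<and> deform_A2 \<Gamma> nu G d dm \<delta>"

section \<open>Groupoid weak delta-structures\<close>

text \<open>Each fibre of the source map carries the distance \<open>d (gdif G g h)\<close>, in which
  \<open>d g\<close> is the distance from \<open>g\<close> to the object \<open>gsrc G g\<close>.\<close>

definition object_nbhd :: "'g grpd \<Rightarrow> ('g \<Rightarrow> real) \<Rightarrow> 'g set \<Rightarrow> bool" where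
  "object_nbhd G d U \<longleftrightarrow>
     U \<subseteq> arrows G \<and> (\<forall>x\<in>objects G. \<exists>r>0. \<forall>g\<in>fibre G x. d g < r \<longrightarrow> g \<in> U)"

text \<open>Convergence is convergence of (filters of) arrows of the double groupoid to 0 in norm; applied
  to constant nets it gives that \<open>d0 (g, h) = 0\<close> implies \<open>g = h\<close>.\<close>

definition weak_A3 :: "('s, 'm) monoid_scheme \<Rightarrow> ('s \<Rightarrow> real) \<Rightarrow> 'g grpd \<Rightarrow> ('g \<Rightarrow> real) \<Rightarrow>
    ('s \<Rightarrow> 'g set) \<Rightarrow> ('s \<Rightarrow> 'g \<Rightarrow> 'g) \<Rightarrow> 'g set \<Rightarrow> ('g \<times> 'g \<Rightarrow> real) \<Rightarrow> bool" where
  "weak_A3 \<Gamma> nu G d dm \<delta> U d0 \<longleftrightarrow>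
     object_nbhd G d U \<and>
     (\<forall>b>0. unif_vanishing \<Gamma> nu
        (\<lambda>\<epsilon>. {(g, h) \<in> arrows (double_groupoid G U). g \<in> dm \<epsilon> \<and> h \<in> dm \<epsilon> \<and> d g \<le> b \<and> d h \<le> b})
        (\<lambda>\<epsilon> (g, h). \<bar>1 / nu \<epsilon> * d (gdif G (\<delta> \<epsilon> g) (\<delta> \<epsilon> h)) - d0 (g, h)\<bar>)) \<and>
     (\<forall>F. (\<forall>\<^sub>F a in F. a \<in> arrows (double_groupoid G U)) \<longrightarrow>
        ((d0 \<longlongrightarrow> 0) F \<longleftrightarrow> ((\<lambda>(g, h). d (gdif G g h)) \<longlongrightarrow> 0) F))"

text \<open>The first component of the transformation \<open>(\<mu>, \<epsilon>)\<close> of $G\times_\alpha G$ (its second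
  component is the identity), and the pairs for which it is defined.\<close>

definition induced_map :: "('s, 'm) monoid_scheme \<Rightarrow> 'g grpd \<Rightarrow> ('s \<Rightarrow> 'g \<Rightarrow> 'g) \<Rightarrow>
    's \<Rightarrow> 's \<Rightarrow> 'g \<times> 'g \<Rightarrow> 'g" where
  "induced_map \<Gamma> G \<delta> \<mu> \<epsilon> = (\<lambda>(g, h).
     \<delta> (inv\<^bsub>\<Gamma>\<^esub> \<mu>) (gmult G (\<delta> \<epsilon> (gdif G (\<delta> \<mu> g) (\<delta> \<mu> h))) (\<delta> \<mu> h)))"

definition induced_dom :: "('s, 'm) monoid_scheme \<Rightarrow> 'g grpd \<Rightarrow> ('s \<Rightarrow> 'g set) \<Rightarrow>
    ('s \<Rightarrow> 'g \<Rightarrow> 'g) \<Rightarrow> 's \<Rightarrow> 's \<Rightarrow> ('g \<times> 'g) set" where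
  "induced_dom \<Gamma> G dm \<delta> \<mu> \<epsilon> =
     {(g, h). g \<in> dm \<mu> \<and> h \<in> dm \<mu> \<and> gsrc G g = gsrc G h \<and>
        gdif G (\<delta> \<mu> g) (\<delta> \<mu> h) \<in> dm \<epsilon> \<and>
        gmult G (\<delta> \<epsilon> (gdif G (\<delta> \<mu> g) (\<delta> \<mu> h))) (\<delta> \<mu> h) \<in> dm (inv\<^bsub>\<Gamma>\<^esub> \<mu>)}"

text \<open>On a bounded set the limit has to be defined wherever the approximating transformations of
  small parameter are. The first components determine the convergence because \<open>\<delta>b \<epsilon>\<close> preserves
  sources, so that \<open>snd (\<delta>b \<epsilon> (g, h)) = h\<close>.\<close>

definition weak_A4 :: "('s, 'm) monoid_scheme \<Rightarrow> ('s \<Rightarrow> real) \<Rightarrow> 'g grpd \<Rightarrow> ('g \<Rightarrow> real) \<Rightarrow>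
    ('s \<Rightarrow> 'g set) \<Rightarrow> ('s \<Rightarrow> 'g \<Rightarrow> 'g) \<Rightarrow> 'g set \<Rightarrow> ('g \<times> 'g \<Rightarrow> real) \<Rightarrow> bool" where
  "weak_A4 \<Gamma> nu G d dm \<delta> U d0 \<longleftrightarrow>
     (\<exists>dmb \<delta>b. deformation \<Gamma> nu (double_groupoid G U) d0 dmb \<delta>b \<and>
        (\<forall>\<epsilon>\<in>carrier \<Gamma>. \<forall>b>0.
           (\<exists>r>0. \<forall>\<mu>\<in>carrier \<Gamma>. nu \<mu> \<le> r \<longrightarrow>
              (\<forall>(g, h)\<in>induced_dom \<Gamma> G dm \<delta> \<mu> \<epsilon>. d g \<le> b \<and> d h \<le> b \<longrightarrow> (g, h) \<in> dmb \<epsilon>)) \<and>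
           unif_vanishing \<Gamma> nu
             (\<lambda>\<mu>. {(g, h) \<in> induced_dom \<Gamma> G dm \<delta> \<mu> \<epsilon>. d g \<le> b \<and> d h \<le> b})
             (\<lambda>\<mu> a. d (gdif G (induced_map \<Gamma> G \<delta> \<mu> \<epsilon> a) (fst (\<delta>b \<epsilon> a))))))"

definition weak_delta_structure :: "('s, 'm) monoid_scheme \<Rightarrow> ('s \<Rightarrow> real) \<Rightarrow> 'g grpd \<Rightarrow>
    ('g \<Rightarrow> real) \<Rightarrow> ('s \<Rightarrow> 'g set) \<Rightarrow> ('s \<Rightarrow> 'g \<Rightarrow> 'g) \<Rightarrow> bool" where
  "weak_delta_structure \<Gamma> nu G d dm \<delta> \<longleftrightarrow>
     deformation \<Gamma> nu G d dm \<delta> \<and>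
     (\<exists>U d0. weak_A3 \<Gamma> nu G d dm \<delta> U d0 \<and> weak_A4 \<Gamma> nu G d dm \<delta> U d0)"

section \<open>Dilatation structures\<close>

text \<open>$\bar\Gamma$, with \<open>None\<close> in the role of 0.\<close>

definition scale_topology :: "('s, 'm) monoid_scheme \<Rightarrow> ('s \<Rightarrow> real) \<Rightarrow> 's option topology" where
  "scale_topology \<Gamma> nu = topology (\<lambda>V. V \<subseteq> insert None (Some ` carrier \<Gamma>) \<and>
     (None \<in> V \<longrightarrow> (\<exists>r>0. \<forall>\<epsilon>\<in>carrier \<Gamma>. nu \<epsilon> < r \<longrightarrow> Some \<epsilon> \<in> V)))"

lemma openin_scale_topology:
  "openin (scale_topology \<Gamma> nu) V \<longleftrightarrow> V \<subseteq> insert None (Some ` carrier \<Gamma>) \<and>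
     (None \<in> V \<longrightarrow> (\<exists>r>0. \<forall>\<epsilon>\<in>carrier \<Gamma>. nu \<epsilon> < r \<longrightarrow> Some \<epsilon> \<in> V))"
proof -
  have "istopology (\<lambda>V. V \<subseteq> insert None (Some ` carrier \<Gamma>) \<and>
     (None \<in> V \<longrightarrow> (\<exists>r>0. \<forall>\<epsilon>\<in>carrier \<Gamma>. nu \<epsilon> < r \<longrightarrow> Some \<epsilon> \<in> V)))" (is "istopology ?P")
    unfolding istopology_def
  proof (intro conjI allI impI)
    fix S T assume S: "?P S" and T: "?P T"
    show "S \<inter> T \<subseteq> insert None (Some ` carrier \<Gamma>)" using S by blast
    assume N: "None \<in> S \<inter> T"
    obtain r where r: "r > 0" "\<forall>\<epsilon>\<in>carrier \<Gamma>. nu \<epsilon> < r \<longrightarrow> Some \<epsilon> \<in> S"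
      using S N by blast
    obtain s where s: "s > 0" "\<forall>\<epsilon>\<in>carrier \<Gamma>. nu \<epsilon> < s \<longrightarrow> Some \<epsilon> \<in> T"
      using T N by blast
    show "\<exists>r>0. \<forall>\<epsilon>\<in>carrier \<Gamma>. nu \<epsilon> < r \<longrightarrow> Some \<epsilon> \<in> S \<inter> T"
      by (rule exI[of _ "min r s"]) (simp add: r s)
  next
    fix \<K> assume K: "\<forall>S\<in>\<K>. ?P S"
    show "\<Union>\<K> \<subseteq> insert None (Some ` carrier \<Gamma>)" using K by blast
    assume "None \<in> \<Union>\<K>"
    then obtain S where "S \<in> \<K>" "None \<in> S" by blast
    moreover from this K obtain r where "r > 0" "\<forall>\<epsilon>\<in>carrier \<Gamma>. nu \<epsilon> < r \<longrightarrow> Some \<epsilon> \<in> S"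
      by blast
    ultimately show "\<exists>r>0. \<forall>\<epsilon>\<in>carrier \<Gamma>. nu \<epsilon> < r \<longrightarrow> Some \<epsilon> \<in> \<Union>\<K>"
      by blast
  qed
  then show ?thesis
    by (simp add: scale_topology_def topology_inverse')
qed

definition dilat_A1 :: "('s, 'm) monoid_scheme \<Rightarrow> 'x set \<Rightarrow> ('x \<Rightarrow> 'x \<Rightarrow> real) \<Rightarrow>
    ('s \<Rightarrow> 'x \<Rightarrow> 'x set) \<Rightarrow> ('s \<Rightarrow> 'x \<Rightarrow> 'x \<Rightarrow> 'x) \<Rightarrow> bool" where
  "dilat_A1 \<Gamma> X \<rho> dm \<delta> \<longleftrightarrow>
     (\<forall>x\<in>X.
        (\<forall>\<epsilon>\<in>carrier \<Gamma>. dm \<epsilon> x \<subseteq> X \<and> x \<in> dm \<epsilon> x \<and> \<delta> \<epsilon> x x = x \<and>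
           homeomorphic_maps
             (subtopology (Metric_space.mtopology X \<rho>) (dm \<epsilon> x))
             (subtopology (Metric_space.mtopology X \<rho>) (dm (inv\<^bsub>\<Gamma>\<^esub> \<epsilon>) x))
             (\<delta> \<epsilon> x) (\<delta> (inv\<^bsub>\<Gamma>\<^esub> \<epsilon>) x)) \<and>
        (\<forall>y\<in>dm \<one>\<^bsub>\<Gamma>\<^esub> x. \<delta> \<one>\<^bsub>\<Gamma>\<^esub> x y = y) \<and>
        (\<forall>\<epsilon>\<in>carrier \<Gamma>. \<forall>\<mu>\<in>carrier \<Gamma>. \<forall>y\<in>dm \<mu> x. \<delta> \<mu> x y \<in> dm \<epsilon> x \<longrightarrow>
           y \<in> dm (\<epsilon> \<otimes>\<^bsub>\<Gamma>\<^esub> \<mu>) x \<and> \<delta> \<epsilon> x (\<delta> \<mu> x y) = \<delta> (\<epsilon> \<otimes>\<^bsub>\<Gamma>\<^esub> \<mu>) x y))"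

text \<open>Continuity of the extension to $\bar\Gamma\times X\times X$ includes that of \<open>\<delta>\<close> itself,
  the subset of all \<open>Some \<epsilon>\<close> being open and discrete.\<close>

definition dilat_A2 :: "('s, 'm) monoid_scheme \<Rightarrow> ('s \<Rightarrow> real) \<Rightarrow> 'x set \<Rightarrow> ('x \<Rightarrow> 'x \<Rightarrow> real) \<Rightarrow>
    ('s \<Rightarrow> 'x \<Rightarrow> 'x set) \<Rightarrow> ('s \<Rightarrow> 'x \<Rightarrow> 'x \<Rightarrow> 'x) \<Rightarrow> bool" where
  "dilat_A2 \<Gamma> nu X \<rho> dm \<delta> \<longleftrightarrow>
     continuous_map
       (subtopology
          (prod_topology (scale_topology \<Gamma> nu)
             (prod_topology (Metric_space.mtopology X \<rho>) (Metric_space.mtopology X \<rho>)))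
          {(t, x, y). case t of None \<Rightarrow> True | Some \<epsilon> \<Rightarrow> y \<in> dm \<epsilon> x})
       (Metric_space.mtopology X \<rho>)
       (\<lambda>(t, x, y). case t of None \<Rightarrow> x | Some \<epsilon> \<Rightarrow> \<delta> \<epsilon> x y) \<and>
     (\<forall>S. Metric_space.mbounded X \<rho> S \<longrightarrow>
        unif_vanishing \<Gamma> nu (\<lambda>\<epsilon>. {(x, y). x \<in> S \<and> y \<in> S \<and> y \<in> dm \<epsilon> x})
          (\<lambda>\<epsilon> (x, y). \<rho> (\<delta> \<epsilon> x y) x))"

definition dist_uniformity :: "'x set \<Rightarrow> ('x \<Rightarrow> 'x \<Rightarrow> real) \<Rightarrow> ('x \<times> 'x) filter" where
  "dist_uniformity Y \<rho> = (INF e\<in>{0<..}. principal {(u, v). u \<in> Y \<and> v \<in> Y \<and> \<rho> u v < e})"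

definition dilat_A3 :: "('s, 'm) monoid_scheme \<Rightarrow> ('s \<Rightarrow> real) \<Rightarrow> 'x set \<Rightarrow> ('x \<Rightarrow> 'x \<Rightarrow> real) \<Rightarrow>
    ('s \<Rightarrow> 'x \<Rightarrow> 'x set) \<Rightarrow> ('s \<Rightarrow> 'x \<Rightarrow> 'x \<Rightarrow> 'x) \<Rightarrow> bool" where
  "dilat_A3 \<Gamma> nu X \<rho> dm \<delta> \<longleftrightarrow>
     (\<exists>A>1. \<exists>dx :: 'x \<Rightarrow> 'x \<Rightarrow> 'x \<Rightarrow> real.
        (\<forall>S. Metric_space.mbounded X \<rho> S \<longrightarrow>
           unif_vanishing \<Gamma> nu
             (\<lambda>\<epsilon>. {(x, u, v). x \<in> S \<and>
                u \<in> Metric_space.mcball X \<rho> x A \<and> v \<in> Metric_space.mcball X \<rho> x A \<and>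
                u \<in> dm \<epsilon> x \<and> v \<in> dm \<epsilon> x})
             (\<lambda>\<epsilon> (x, u, v). \<bar>1 / nu \<epsilon> * \<rho> (\<delta> \<epsilon> x u) (\<delta> \<epsilon> x v) - dx x u v\<bar>)) \<and>
        (\<forall>x\<in>X. dist_uniformity (Metric_space.mcball X \<rho> x A) (dx x) =
               dist_uniformity (Metric_space.mcball X \<rho> x A) \<rho>))"

definition dilat_A4weak :: "('s, 'm) monoid_scheme \<Rightarrow> ('s \<Rightarrow> real) \<Rightarrow> 'x set \<Rightarrow>
    ('x \<Rightarrow> 'x \<Rightarrow> real) \<Rightarrow> ('s \<Rightarrow> 'x \<Rightarrow> 'x set) \<Rightarrow> ('s \<Rightarrow> 'x \<Rightarrow> 'x \<Rightarrow> 'x) \<Rightarrow> bool" where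
  "dilat_A4weak \<Gamma> nu X \<rho> dm \<delta> \<longleftrightarrow>
     (\<forall>\<mu>\<in>carrier \<Gamma>. \<exists>\<delta>b :: 'x \<Rightarrow> 'x \<Rightarrow> 'x \<Rightarrow> 'x.
        (\<forall>x\<in>X. \<forall>u\<in>X. \<forall>v\<in>X. \<delta>b x u v \<in> X) \<and>
        (\<forall>S. Metric_space.mbounded X \<rho> S \<longrightarrow>
           unif_vanishing \<Gamma> nu
             (\<lambda>\<epsilon>. {(x, u, v). x \<in> S \<and> u \<in> S \<and> v \<in> S \<and> u \<in> dm \<epsilon> x \<and> v \<in> dm \<epsilon> x \<and>
                \<delta> \<epsilon> x v \<in> dm \<mu> (\<delta> \<epsilon> x u) \<and>
                \<delta> \<mu> (\<delta> \<epsilon> x u) (\<delta> \<epsilon> x v) \<in> dm (inv\<^bsub>\<Gamma>\<^esub> \<epsilon>) x})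
             (\<lambda>\<epsilon> (x, u, v).
                \<rho> (\<delta> (inv\<^bsub>\<Gamma>\<^esub> \<epsilon>) x (\<delta> \<mu> (\<delta> \<epsilon> x u) (\<delta> \<epsilon> x v))) (\<delta>b x u v))))"

definition dilatation_structure :: "('s, 'm) monoid_scheme \<Rightarrow> ('s \<Rightarrow> real) \<Rightarrow> 'x set \<Rightarrow>
    ('x \<Rightarrow> 'x \<Rightarrow> real) \<Rightarrow> ('s \<Rightarrow> 'x \<Rightarrow> 'x set) \<Rightarrow> ('s \<Rightarrow> 'x \<Rightarrow> 'x \<Rightarrow> 'x) \<Rightarrow> bool" where
  "dilatation_structure \<Gamma> nu X \<rho> dm \<delta> \<longleftrightarrow>
     Metric_space X \<rho> \<and> dilat_A1 \<Gamma> X \<rho> dm \<delta> \<and> dilat_A2 \<Gamma> nu X \<rho> dm \<delta> \<and>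
     dilat_A3 \<Gamma> nu X \<rho> dm \<delta> \<and> dilat_A4weak \<Gamma> nu X \<rho> dm \<delta>"

section \<open>The induced structure on a fibre\<close>

text \<open>The value 0 outside the fibre only serves the conventions of \<open>Metric_space\<close>, which
  constrain a distance also outside of its carrier.\<close>

definition fibre_dist :: "'g grpd \<Rightarrow> ('g \<Rightarrow> real) \<Rightarrow> 'g \<Rightarrow> 'g \<Rightarrow> 'g \<Rightarrow> real" where
  "fibre_dist G d x g h = (if g \<in> fibre G x \<and> h \<in> fibre G x then d (gdif G g h) else 0)"

definition fibre_dom :: "'g grpd \<Rightarrow> ('s \<Rightarrow> 'g set) \<Rightarrow> 'g \<Rightarrow> 's \<Rightarrow> 'g \<Rightarrow> 'g set" where
  "fibre_dom G dm x \<epsilon> h = {g \<in> fibre G x. gdif G g h \<in> dm \<epsilon>}"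

definition fibre_dil :: "'g grpd \<Rightarrow> ('s \<Rightarrow> 'g \<Rightarrow> 'g) \<Rightarrow> 's \<Rightarrow> 'g \<Rightarrow> 'g \<Rightarrow> 'g" where
  "fibre_dil G \<delta> \<epsilon> h g = gmult G (\<delta> \<epsilon> (gdif G g h)) h"

end

theory Submission
  imports Defs
begin

text \<open>Right translation by \<open>h\<close> identifies pairs of points of the fibre over \<open>x\<close> with pairs of points
  of the fibre over the target of \<open>h\<close> and preserves \<open>d (gdif G g h)\<close>. It turns the dilatations
  based at \<open>h\<close> into \<open>\<delta>\<close>, and the expression in A4weak into the induced map.
  The limits in A3 are only given for arrows in \<open>U\<close>, whereas balls of radius greater than 1 need
  not lie in \<open>U\<close>. However, \<open>(g, g)\<close> belongs to the domain of every induced map at scale \<open>\<mu>\<close>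
  if \<open>g \<in> dm \<mu>\<close>, and A4weak places these domains in \<open>U\<^sup>2\<close> for small \<open>\<mu>\<close>.\<close>

section \<open>Groupoid identities\<close>

context groupoid
begin

section \<open>Sources, targets and objects\<close>

lemma src_closed: "g \<in> arrows G \<Longrightarrow> gsrc G g \<in> arrows G"
  by (simp add: gsrc_def inv_closed mult_closed flip: src_inv)

text \<open>A source is by definition the product of \<open>ginv G g\<close> and \<open>g\<close>,
  so the rule for sources of products applies to it; \<open>tgt_src\<close> uses the rule for
  targets in the same way.\<close>

lemma src_src: "g \<in> arrows G \<Longrightarrow> gsrc G (gsrc G g) = gsrc G g"
  using src_mult[of "ginv G g" g] by (simp add: inv_closed src_inv flip: gsrc_def)

lemma tgt_src: "g \<in> arrows G \<Longrightarrow> gtgt G (gsrc G g) = gsrc G g"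
  using tgt_mult[of "ginv G g" g] by (simp add: inv_closed src_inv tgt_inv flip: gsrc_def)

lemma objectD:
  assumes "y \<in> objects G"
  shows "y \<in> arrows G" "gsrc G y = y" "gtgt G y = y"
  using assms by (auto simp: objects_def src_closed src_src tgt_src)

lemma src_in_objects: "g \<in> arrows G \<Longrightarrow> gsrc G g \<in> objects G"
  by (simp add: objects_def)

text \<open>Objects are defined as sources, and the target of \<open>g\<close> is the source of its
  inverse.\<close>

lemma tgt_in_objects: "g \<in> arrows G \<Longrightarrow> gtgt G g \<in> objects G"
  using src_in_objects[of "ginv G g"] by (simp add: inv_closed src_inv)

text \<open>Multiplying the identity arrow \<open>ab\<close> on the right by the inverse of
  \<open>b\<close> isolates \<open>a\<close>. This is used to recognise the inverse of a difference
  in \<open>inv_dif\<close>.\<close>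

lemma inv_unique:
  assumes a: "a \<in> arrows G" and b: "b \<in> arrows G" and "gtgt G b = gsrc G a"
    and ab: "gmult G a b = gsrc G b"
  shows "a = ginv G b"
proof -
  have "a = gmult G a (gmult G b (ginv G b))"
    using assms by (metis gtgt_def mult_src)
  also have "\<dots> = gmult G (gmult G a b) (ginv G b)"
    by (rule mult_assoc[symmetric]) (use assms in \<open>simp_all add: inv_closed tgt_inv\<close>)
  also have "\<dots> = ginv G b"
    using b by (metis ab inv_closed tgt_inv tgt_mult_self)
  finally show ?thesis .
qed

section \<open>Calculus of differences\<close>

lemma dif_closed [intro]:
  "\<lbrakk>g \<in> arrows G; h \<in> arrows G; gsrc G g = gsrc G h\<rbrakk> \<Longrightarrow> gdif G g h \<in> arrows G"
  by (simp add: gdif_def inv_closed mult_closed tgt_inv)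

lemma src_dif:
  "\<lbrakk>g \<in> arrows G; h \<in> arrows G; gsrc G g = gsrc G h\<rbrakk> \<Longrightarrow> gsrc G (gdif G g h) = gtgt G h"
  by (simp add: gdif_def inv_closed src_inv src_mult tgt_inv)

lemma tgt_dif:
  "\<lbrakk>g \<in> arrows G; h \<in> arrows G; gsrc G g = gsrc G h\<rbrakk> \<Longrightarrow> gtgt G (gdif G g h) = gtgt G g"
  by (simp add: gdif_def inv_closed tgt_mult tgt_inv)

lemma dif_self: "gdif G g g = gtgt G g"
  by (simp add: gdif_def gtgt_def)

lemma dif_mult_cancel:
  assumes "g \<in> arrows G" "h \<in> arrows G" "gsrc G g = gsrc G h"
  shows "gmult G (gdif G g h) h = g"
proof -
  have "gmult G (gdif G g h) h = gmult G g (gmult G (ginv G h) h)"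
    unfolding gdif_def using assms by (simp add: mult_assoc inv_closed tgt_inv src_inv)
  also have "\<dots> = g"
    using assms by (metis gsrc_def mult_src)
  finally show ?thesis .
qed

lemma mult_dif:
  assumes "a \<in> arrows G" "h \<in> arrows G" "k \<in> arrows G" "gsrc G a = gtgt G h" "gsrc G h = gsrc G k"
  shows "gmult G a (gdif G h k) = gdif G (gmult G a h) k"
  using assms by (simp add: gdif_def mult_assoc inv_closed tgt_inv)

lemma mult_dif_cancel:
  assumes "a \<in> arrows G" "h \<in> arrows G" "gsrc G a = gtgt G h"
  shows "gdif G (gmult G a h) h = a"
  using mult_dif[of a h h] assms by (metis dif_self mult_src)

text \<open>The inner factors \<open>h^-1 h\<close> cancel. In terms of the double groupoid, where
  \<open>(g,h)(h,k) = (g,k)\<close>, this makes \<open>gdif\<close> multiplicative; it is the source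
  of the triangle inequality.\<close>

lemma dif_mult_dif:
  assumes "g \<in> arrows G" "h \<in> arrows G" "k \<in> arrows G"
    and "gsrc G g = gsrc G h" "gsrc G h = gsrc G k"
  shows "gmult G (gdif G g h) (gdif G h k) = gdif G g k"
  using assms by (simp add: mult_dif dif_closed src_dif dif_mult_cancel)

lemma inv_dif:
  assumes "g \<in> arrows G" "h \<in> arrows G" "gsrc G g = gsrc G h"
  shows "ginv G (gdif G g h) = gdif G h g"
  by (rule inv_unique[symmetric])
    (use assms in \<open>simp_all add: dif_closed src_dif tgt_dif dif_mult_dif dif_self\<close>)

text \<open>The inverse of the second factor is \<open>k h^-1\<close>, so the two copies of
  \<open>k\<close> cancel. Differences therefore do not notice a change of base point.\<close>

lemma dif_dif:
  assumes "g \<in> arrows G" "h \<in> arrows G" "k \<in> arrows G"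
    and "gsrc G g = gsrc G k" "gsrc G h = gsrc G k"
  shows "gdif G (gdif G g k) (gdif G h k) = gdif G g h"
proof -
  have "gdif G (gdif G g k) (gdif G h k) = gmult G (gdif G g k) (gdif G k h)"
    unfolding gdif_def[of G "gdif G g k"] using assms by (simp add: inv_dif)
  then show ?thesis
    using assms by (simp add: dif_mult_dif)
qed

text \<open>This is \<open>dif_dif\<close> for the arrows \<open>ah\<close> and \<open>bh\<close>,
  whose differences with \<open>h\<close> are \<open>a\<close> and \<open>b\<close>.\<close>

lemma dif_mult_mult:
  assumes "a \<in> arrows G" "b \<in> arrows G" "h \<in> arrows G" "gsrc G a = gtgt G h" "gsrc G b = gtgt G h"
  shows "gdif G (gmult G a h) (gmult G b h) = gdif G a b"
  using dif_dif[of "gmult G a h" "gmult G b h" h] assms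
  by (simp add: mult_closed src_mult mult_dif_cancel)

text \<open>An object is an identity arrow, so multiplying \<open>g h^-1\<close> by \<open>h\<close>
  returns both \<open>g\<close> and \<open>h\<close>. This gives the definiteness of the fibre
  distance.\<close>

lemma dif_object_imp_eq:
  assumes "g \<in> arrows G" "h \<in> arrows G" "gsrc G g = gsrc G h" "gdif G g h \<in> objects G"
  shows "g = h"
  using assms by (metis dif_mult_cancel objectD(2) src_dif tgt_mult_self)

lemma fibreD:
  assumes "g \<in> fibre G x"
  shows "g \<in> arrows G" "gsrc G g = x"
  using assms by (auto simp: fibre_def)

lemma mult_in_fibre:
  "\<lbrakk>a \<in> arrows G; h \<in> fibre G x; gsrc G a = gtgt G h\<rbrakk> \<Longrightarrow> gmult G a h \<in> fibre G x"
  by (simp add: fibre_def mult_closed src_mult)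

end

section \<open>The fibre as a metric space\<close>

locale normed_groupoid = groupoid G for G :: "'g grpd" +
  fixes d :: "'g \<Rightarrow> real"
  assumes norm: "groupoid_norm G d"
begin

lemma norm_nonneg: "g \<in> arrows G \<Longrightarrow> 0 \<le> d g"
  and norm_eq_0_iff: "g \<in> arrows G \<Longrightarrow> d g = 0 \<longleftrightarrow> g \<in> objects G"
  and norm_inv: "g \<in> arrows G \<Longrightarrow> d (ginv G g) = d g"
  and norm_mult: "\<lbrakk>g \<in> arrows G; h \<in> arrows G; gtgt G h = gsrc G g\<rbrakk> \<Longrightarrow> d (gmult G g h) \<le> d g + d h"
  using norm by (auto simp: groupoid_norm_def)

lemma fibre_dist_eq: "\<lbrakk>g \<in> fibre G x; h \<in> fibre G x\<rbrakk> \<Longrightarrow> fibre_dist G d x g h = d (gdif G g h)"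
  by (simp add: fibre_dist_def)

lemma norm_dif_commute:
  "\<lbrakk>g \<in> arrows G; h \<in> arrows G; gsrc G g = gsrc G h\<rbrakk> \<Longrightarrow> d (gdif G g h) = d (gdif G h g)"
  by (metis dif_closed inv_dif norm_inv)

lemma Metric_space_fibre: "Metric_space (fibre G x) (fibre_dist G d x)"
proof
  fix g h
  show "0 \<le> fibre_dist G d x g h"
    by (auto simp: fibre_dist_def fibre_def intro!: norm_nonneg)
  show "fibre_dist G d x g h = fibre_dist G d x h g"
    by (auto simp: fibre_dist_def fibre_def norm_dif_commute)
next
  fix g h assume gh: "g \<in> fibre G x" "h \<in> fibre G x"
  have "d (gdif G g h) = 0 \<longleftrightarrow> gdif G g h \<in> objects G"
    using gh by (intro norm_eq_0_iff) (auto simp: fibre_def)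
  also have "\<dots> \<longleftrightarrow> g = h"
    using gh by (auto simp: dif_self tgt_in_objects fibre_def intro: dif_object_imp_eq)
  finally show "fibre_dist G d x g h = 0 \<longleftrightarrow> g = h"
    using gh by (simp add: fibre_dist_eq)
  fix k assume k: "k \<in> fibre G x"
  \<comment> \<open>Subadditivity of the norm, applied to the factorisation of \<open>g k^-1\<close>
    as \<open>(g h^-1)(h k^-1)\<close>.\<close>
  have "d (gdif G g k) \<le> d (gdif G g h) + d (gdif G h k)"
    using gh k norm_mult[of "gdif G g h" "gdif G h k"]
    by (auto simp: fibre_def dif_closed src_dif tgt_dif dif_mult_dif)
  then show "fibre_dist G d x g k \<le> fibre_dist G d x g h + fibre_dist G d x h k"
    using gh k by (simp add: fibre_dist_eq)
qed

text \<open>Right translation by \<open>h\<close> is an isometry from the fibre over the target of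
  \<open>h\<close> to the fibre over \<open>x\<close>. Estimates for \<open>\<delta>\<close> thereby
  become estimates for dilatations based at \<open>h\<close>.\<close>

lemma fibre_dist_mult_mult:
  assumes "a \<in> arrows G" "b \<in> arrows G" "h \<in> fibre G x" "gsrc G a = gtgt G h" "gsrc G b = gtgt G h"
  shows "fibre_dist G d x (gmult G a h) (gmult G b h) = d (gdif G a b)"
  using assms by (simp add: fibre_dist_eq mult_in_fibre dif_mult_mult fibreD)

text \<open>Limits in the fibre are uniform in the base point, limits of a deformation are uniform
  under a norm bound. A bound on the diameter of \<open>S\<close> controls the differences from all
  base points in \<open>S\<close> at once.\<close>

lemma mbounded_fibre_norm_dif:
  assumes "Metric_space.mbounded (fibre G x) (fibre_dist G d x) S"
  obtains b where "0 < b" "S \<subseteq> fibre G x" "\<And>g h. \<lbrakk>g \<in> S; h \<in> S\<rbrakk> \<Longrightarrow> d (gdif G g h) \<le> b"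
proof -
  interpret Metric_space "fibre G x" "fibre_dist G d x"
    by (rule Metric_space_fibre)
  obtain b where "0 < b" "S \<subseteq> fibre G x" "\<And>g h. \<lbrakk>g \<in> S; h \<in> S\<rbrakk> \<Longrightarrow> fibre_dist G d x g h \<le> b"
    using assms unfolding mbounded_alt_pos by blast
  then show thesis
    by (intro that[of b]) (auto simp: subset_iff, metis fibre_dist_eq)
qed

end

section \<open>Dilatations of the fibre\<close>

lemma unif_vanishingE:
  assumes "unif_vanishing \<Gamma> nu E err" "0 < \<eta>"
  obtains r where "0 < r" "\<And>\<epsilon> a. \<lbrakk>\<epsilon> \<in> carrier \<Gamma>; nu \<epsilon> \<le> r; a \<in> E \<epsilon>\<rbrakk> \<Longrightarrow> err \<epsilon> a \<le> \<eta>"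
  using assms unfolding unif_vanishing_def by blast

text \<open>The prefix \<open>scale\<close> separates the facts of the group of scales from those of
  the groupoid, since names such as \<open>inv_closed\<close> occur in both.\<close>

locale deformed_groupoid = scale: scale_group \<Gamma> nu + normed_groupoid G d
  for \<Gamma> :: "('s, 'm) monoid_scheme" (structure) and nu :: "'s \<Rightarrow> real"
    and G :: "'g grpd" and d :: "'g \<Rightarrow> real" +
  fixes dm :: "'s \<Rightarrow> 'g set" and \<delta> :: "'s \<Rightarrow> 'g \<Rightarrow> 'g"
  assumes deformation: "deformation \<Gamma> nu G d dm \<delta>"
begin

section \<open>The axioms of a deformation as rules\<close>

lemma
  assumes "\<epsilon> \<in> carrier \<Gamma>"
  shows continuous: "continuous_transformation G d (dm \<epsilon>) (\<delta> \<epsilon>)"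
    and objects_dom: "objects G \<subseteq> dm \<epsilon>"
    and dil_object: "y \<in> objects G \<Longrightarrow> \<delta> \<epsilon> y = y"
  using deformation assms
  by (auto simp: deformation_def deform_A0_def deform_A1_def deform_A2_def)

lemma
  assumes "\<epsilon> \<in> carrier \<Gamma>" "g \<in> dm \<epsilon>"
  shows dil_closed: "\<delta> \<epsilon> g \<in> arrows G"
    and src_dil: "gsrc G (\<delta> \<epsilon> g) = gsrc G g"
    and dil_in_dom: "\<delta> \<epsilon> g \<in> dm (inv \<epsilon>)"
    and dil_inv_dil: "\<delta> (inv \<epsilon>) (\<delta> \<epsilon> g) = g"
  using deformation assms
  by (auto simp: deformation_def deform_A1_def)

lemma
  assumes "\<epsilon> \<in> carrier \<Gamma>" "\<mu> \<in> carrier \<Gamma>" "g \<in> dm \<mu>" "\<delta> \<mu> g \<in> dm \<epsilon>"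
  shows dom_mult: "g \<in> dm (\<epsilon> \<otimes> \<mu>)"
    and dil_dil: "\<delta> \<epsilon> (\<delta> \<mu> g) = \<delta> (\<epsilon> \<otimes> \<mu>) g"
  using deformation assms
  by (auto simp: deformation_def deform_A1_def)

lemma dil_one: "g \<in> dm \<one> \<Longrightarrow> \<delta> \<one> g = g"
  using deformation by (auto simp: deformation_def deform_A1_def)

lemma dil_vanishing:
  assumes "0 < b" "0 < \<eta>"
  obtains r where "0 < r"
    "\<And>\<epsilon> g. \<lbrakk>\<epsilon> \<in> carrier \<Gamma>; nu \<epsilon> \<le> r; g \<in> dm \<epsilon>; d g \<le> b\<rbrakk> \<Longrightarrow> d (\<delta> \<epsilon> g) \<le> \<eta>"
proof -
  have "unif_vanishing \<Gamma> nu (\<lambda>\<epsilon>. {g \<in> dm \<epsilon>. d g \<le> b}) (\<lambda>\<epsilon> g. d (\<delta> \<epsilon> g))"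
    using deformation assms by (simp add: deformation_def deform_A2_def)
  then show thesis
    using assms(2) by (rule unif_vanishingE) (simp add: that)
qed

text \<open>Since \<open>\<delta> \<epsilon>\<close> preserves sources, its value can be multiplied
  by \<open>h\<close> again. The last fact says that passing to differences from the base point
  conjugates the dilatation at \<open>h\<close> to \<open>\<delta> \<epsilon>\<close>; the axioms
  are transferred through it.\<close>

lemma
  assumes "\<epsilon> \<in> carrier \<Gamma>" "h \<in> fibre G x" "g \<in> fibre_dom G dm x \<epsilon> h"
  shows fibre_domD: "g \<in> fibre G x" "gdif G g h \<in> dm \<epsilon>"
    and src_dil_dif: "gsrc G (\<delta> \<epsilon> (gdif G g h)) = gtgt G h"
    and dil_dif_closed: "\<delta> \<epsilon> (gdif G g h) \<in> arrows G"
    and fibre_dil_in_fibre: "fibre_dil G \<delta> \<epsilon> h g \<in> fibre G x"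
    and dif_fibre_dil: "gdif G (fibre_dil G \<delta> \<epsilon> h g) h = \<delta> \<epsilon> (gdif G g h)"
proof -
  show g: "g \<in> fibre G x" and gh: "gdif G g h \<in> dm \<epsilon>"
    using assms by (auto simp: fibre_dom_def)
  show s: "gsrc G (\<delta> \<epsilon> (gdif G g h)) = gtgt G h" and c: "\<delta> \<epsilon> (gdif G g h) \<in> arrows G"
    using assms g gh by (simp_all add: src_dil src_dif fibreD dil_closed)
  show "fibre_dil G \<delta> \<epsilon> h g \<in> fibre G x"
    unfolding fibre_dil_def using c assms(2) s by (rule mult_in_fibre)
  show "gdif G (fibre_dil G \<delta> \<epsilon> h g) h = \<delta> \<epsilon> (gdif G g h)"
    unfolding fibre_dil_def using c s assms(2) by (simp add: mult_dif_cancel fibreD)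
qed

lemma fibre_dist_fibre_dil_base:
  assumes "\<epsilon> \<in> carrier \<Gamma>" "h \<in> fibre G x" "g \<in> fibre_dom G dm x \<epsilon> h"
  shows "fibre_dist G d x (fibre_dil G \<delta> \<epsilon> h g) h = d (\<delta> \<epsilon> (gdif G g h))"
  using assms by (simp add: fibre_dist_eq fibre_dil_in_fibre dif_fibre_dil)

text \<open>Continuity of the transformation is used at \<open>a = gdif G g h\<close> with \<open>p = gdif G g' g\<close> and
  \<open>q = gdif G h h'\<close>, for which the product \<open>p a q\<close> is \<open>gdif G g' h'\<close>.\<close>

lemma fibre_dil_continuous:
  assumes \<epsilon>: "\<epsilon> \<in> carrier \<Gamma>" and h: "h \<in> fibre G x" and g: "g \<in> fibre_dom G dm x \<epsilon> h" and "0 < \<eta>"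
  obtains \<kappa> where "0 < \<kappa>"
    and "\<And>h' g'. \<lbrakk>h' \<in> fibre G x; g' \<in> fibre_dom G dm x \<epsilon> h';
           fibre_dist G d x h h' \<le> \<kappa>; fibre_dist G d x g g' \<le> \<kappa>\<rbrakk>
         \<Longrightarrow> fibre_dist G d x (fibre_dil G \<delta> \<epsilon> h g) (fibre_dil G \<delta> \<epsilon> h' g') \<le> \<eta>"
proof -
  have ga: "g \<in> arrows G" "gsrc G g = x" and ha: "h \<in> arrows G" "gsrc G h = x"
    and a: "gdif G g h \<in> dm \<epsilon>"
    using fibreD h fibre_domD[OF \<epsilon> h g] by auto
  obtain \<kappa> where "0 < \<kappa>" and \<kappa>: "\<And>p q. \<lbrakk>p \<in> arrows G; q \<in> arrows G; gsrc G p = gtgt G (gdif G g h);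
      gtgt G q = gsrc G (gdif G g h); d p \<le> \<kappa>; d q \<le> \<kappa>; gmult G (gmult G p (gdif G g h)) q \<in> dm \<epsilon>\<rbrakk>
      \<Longrightarrow> d (gdif G (gdif G (\<delta> \<epsilon> (gmult G (gmult G p (gdif G g h)) q)) q) (\<delta> \<epsilon> (gdif G g h))) \<le> \<eta>"
    using continuous[OF \<epsilon>, unfolded continuous_transformation_def, rule_format, OF a \<open>0 < \<eta>\<close>] by blast
  show thesis
  proof (rule that[OF \<open>0 < \<kappa>\<close>])
    fix h' g' assume h': "h' \<in> fibre G x" and g': "g' \<in> fibre_dom G dm x \<epsilon> h'"
      and hd: "fibre_dist G d x h h' \<le> \<kappa>" and gd: "fibre_dist G d x g g' \<le> \<kappa>"
    have ga': "g' \<in> arrows G" "gsrc G g' = x" and ha': "h' \<in> arrows G" "gsrc G h' = x"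
      and a': "gdif G g' h' \<in> dm \<epsilon>"
      using fibreD h' fibre_domD[OF \<epsilon> h' g'] by auto
    have paq: "gmult G (gmult G (gdif G g' g) (gdif G g h)) (gdif G h h') = gdif G g' h'"
      using ga ha ga' ha' by (simp add: dif_mult_dif)
    have "d (gdif G g' g) \<le> \<kappa>" "d (gdif G h h') \<le> \<kappa>"
      using gd hd h h' fibre_domD(1)[OF \<epsilon> h g] fibre_domD(1)[OF \<epsilon> h' g'] ga ga'
      by (simp_all add: fibre_dist_eq norm_dif_commute)
    then have le: "d (gdif G (gdif G (\<delta> \<epsilon> (gdif G g' h')) (gdif G h h')) (\<delta> \<epsilon> (gdif G g h))) \<le> \<eta>"
      using \<kappa>[of "gdif G g' g" "gdif G h h'"] ga ha ga' ha' a'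
      by (simp add: dif_closed src_dif tgt_dif paq)
    let ?y = "fibre_dil G \<delta> \<epsilon> h g" and ?y' = "fibre_dil G \<delta> \<epsilon> h' g'"
    have y: "?y \<in> fibre G x" and y': "?y' \<in> fibre G x"
      using \<epsilon> h g h' g' by (auto intro: fibre_dil_in_fibre)
    \<comment> \<open>The first term is \<open>?y' h'^-1\<close>, so dividing by
      \<open>q = h h'^-1\<close> replaces the base point \<open>h'\<close> by \<open>h\<close>. Only
      then can it be compared with \<open>?y h^-1\<close>.\<close>
    have "gdif G (\<delta> \<epsilon> (gdif G g' h')) (gdif G h h') = gdif G ?y' h"
      using dif_fibre_dil[OF \<epsilon> h' g'] dif_dif[of ?y' h h'] y' ha ha'
      by (metis fibreD dif_dif)
    then have "gdif G (gdif G (\<delta> \<epsilon> (gdif G g' h')) (gdif G h h')) (\<delta> \<epsilon> (gdif G g h)) = gdif G ?y' ?y"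
      using dif_fibre_dil[OF \<epsilon> h g] y y' ha by (metis fibreD dif_dif)
    with le show "fibre_dist G d x ?y ?y' \<le> \<eta>"
      using y y' by (metis fibreD fibre_dist_eq norm_dif_commute)
  qed
qed

text \<open>Joint continuity is specialised to a constant base point. The values lie in the domain
  at scale \<open>inv \<epsilon>\<close> because \<open>\<delta> \<epsilon>\<close> maps its domain
  into that of its inverse.\<close>

lemma fibre_dil_continuous_map:
  assumes \<epsilon>: "\<epsilon> \<in> carrier \<Gamma>" and h: "h \<in> fibre G x"
  shows "continuous_map
    (subtopology (Metric_space.mtopology (fibre G x) (fibre_dist G d x)) (fibre_dom G dm x \<epsilon> h))
    (subtopology (Metric_space.mtopology (fibre G x) (fibre_dist G d x)) (fibre_dom G dm x (inv \<epsilon>) h))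
    (fibre_dil G \<delta> \<epsilon> h)"
proof -
  interpret Metric_space "fibre G x" "fibre_dist G d x"
    by (rule Metric_space_fibre)
  let ?T = "subtopology mtopology (fibre_dom G dm x \<epsilon> h)"
  have "continuous_map ?T mtopology (fibre_dil G \<delta> \<epsilon> h)"
    unfolding continuous_map_to_metric
  proof (intro ballI allI impI)
    fix g and \<eta> :: real assume "g \<in> topspace ?T" "0 < \<eta>"
    then have g: "g \<in> fibre_dom G dm x \<epsilon> h" by simp
    \<comment> \<open>Continuity yields a non-strict estimate; asking for \<open>\<eta> / 2\<close>
      puts the values into the open ball of radius \<open>\<eta>\<close>.\<close>
    obtain \<kappa> where \<kappa>: "0 < \<kappa>" "\<And>h' g'. \<lbrakk>h' \<in> fibre G x; g' \<in> fibre_dom G dm x \<epsilon> h';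
           fibre_dist G d x h h' \<le> \<kappa>; fibre_dist G d x g g' \<le> \<kappa>\<rbrakk>
         \<Longrightarrow> fibre_dist G d x (fibre_dil G \<delta> \<epsilon> h g) (fibre_dil G \<delta> \<epsilon> h' g') \<le> \<eta> / 2"
      using fibre_dil_continuous[OF \<epsilon> h g, of "\<eta> / 2"] \<open>0 < \<eta>\<close> by auto
    have "fibre_dil G \<delta> \<epsilon> h g' \<in> mball (fibre_dil G \<delta> \<epsilon> h g) \<eta>"
      if "g' \<in> mball g \<kappa> \<inter> fibre_dom G dm x \<epsilon> h" for g'
      using \<kappa>(2)[of h g'] that \<open>0 < \<kappa>\<close> \<open>0 < \<eta>\<close> h fibre_dil_in_fibre[OF \<epsilon> h] g by auto
    then show "\<exists>V. openin ?T V \<and> g \<in> V \<and> (\<forall>g'\<in>V. fibre_dil G \<delta> \<epsilon> h g' \<in> mball (fibre_dil G \<delta> \<epsilon> h g) \<eta>)"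
      using fibre_domD(1)[OF \<epsilon> h g] g \<open>0 < \<kappa>\<close>
      by (intro exI[of _ "mball g \<kappa> \<inter> fibre_dom G dm x \<epsilon> h"])
        (auto simp: openin_subtopology_Int)
  qed
  moreover have "fibre_dil G \<delta> \<epsilon> h g \<in> fibre_dom G dm x (inv \<epsilon>) h" if "g \<in> fibre_dom G dm x \<epsilon> h" for g
    using that fibre_dil_in_fibre[OF \<epsilon> h that] dif_fibre_dil[OF \<epsilon> h that] fibre_domD[OF \<epsilon> h that]
    by (simp add: fibre_dom_def dil_in_dom \<epsilon>)
  ultimately show ?thesis
    by (auto simp: continuous_map_in_subtopology)
qed

section \<open>The action by homeomorphisms\<close>

lemma fibre_dil_inv:
  assumes \<epsilon>: "\<epsilon> \<in> carrier \<Gamma>" and h: "h \<in> fibre G x" and g: "g \<in> fibre_dom G dm x \<epsilon> h"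
  shows "fibre_dil G \<delta> (inv \<epsilon>) h (fibre_dil G \<delta> \<epsilon> h g) = g"
proof -
  have "fibre_dil G \<delta> (inv \<epsilon>) h (fibre_dil G \<delta> \<epsilon> h g) = gmult G (gdif G g h) h"
    unfolding fibre_dil_def[of G \<delta> "inv \<epsilon>"]
    using dif_fibre_dil[OF \<epsilon> h g] fibre_domD[OF \<epsilon> h g] by (simp add: dil_inv_dil \<epsilon>)
  then show ?thesis
    using fibre_domD(1)[OF \<epsilon> h g] h by (simp add: dif_mult_cancel fibreD)
qed

lemma dilat_A1_fibre:
  "dilat_A1 \<Gamma> (fibre G x) (fibre_dist G d x) (fibre_dom G dm x) (fibre_dil G \<delta>)"
proof -
  interpret Metric_space "fibre G x" "fibre_dist G d x"
    by (rule Metric_space_fibre)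
  have dom: "fibre_dom G dm x \<epsilon> h \<subseteq> fibre G x" "h \<in> fibre_dom G dm x \<epsilon> h" "fibre_dil G \<delta> \<epsilon> h h = h"
    if "\<epsilon> \<in> carrier \<Gamma>" "h \<in> fibre G x" for \<epsilon> h
    using that objects_dom[of \<epsilon>]
    by (auto simp: fibre_dom_def fibre_dil_def dif_self dil_object fibre_def tgt_in_objects tgt_mult_self)
  \<comment> \<open>Continuity and cancellation are each used twice, at \<open>\<epsilon>\<close>
    and at \<open>inv \<epsilon>\<close>, the inverse of \<open>inv \<epsilon>\<close> being
    \<open>\<epsilon>\<close> again.\<close>
  have hom: "homeomorphic_maps (subtopology mtopology (fibre_dom G dm x \<epsilon> h))
      (subtopology mtopology (fibre_dom G dm x (inv \<epsilon>) h))
      (fibre_dil G \<delta> \<epsilon> h) (fibre_dil G \<delta> (inv \<epsilon>) h)"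
    if "\<epsilon> \<in> carrier \<Gamma>" "h \<in> fibre G x" for \<epsilon> h
    unfolding homeomorphic_maps_def
    using fibre_dil_continuous_map[OF that] fibre_dil_continuous_map[of "inv \<epsilon>" h x]
      fibre_dil_inv[OF that] fibre_dil_inv[of "inv \<epsilon>" h x] that
    by auto
  have one: "fibre_dil G \<delta> \<one> h g = g" if "h \<in> fibre G x" "g \<in> fibre_dom G dm x \<one> h" for h g
    using that by (auto simp: fibre_dil_def fibre_dom_def dil_one dif_mult_cancel fibreD)
  have act: "g \<in> fibre_dom G dm x (\<epsilon> \<otimes> \<mu>) h \<and>
      fibre_dil G \<delta> \<epsilon> h (fibre_dil G \<delta> \<mu> h g) = fibre_dil G \<delta> (\<epsilon> \<otimes> \<mu>) h g"
    if "\<epsilon> \<in> carrier \<Gamma>" "\<mu> \<in> carrier \<Gamma>" and h: "h \<in> fibre G x" and g: "g \<in> fibre_dom G dm x \<mu> h"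
      and "fibre_dil G \<delta> \<mu> h g \<in> fibre_dom G dm x \<epsilon> h" for \<epsilon> \<mu> h g
  proof -
    \<comment> \<open>With this equation, both the domain condition and the second dilatation refer
      to \<open>\<delta> \<mu> (gdif G g h)\<close>, so the action law of \<open>\<delta>\<close>
      applies literally.\<close>
    note eq = dif_fibre_dil[OF that(2) h g]
    have "\<delta> \<mu> (gdif G g h) \<in> dm \<epsilon>"
      using that(5) eq by (simp add: fibre_dom_def)
    then show ?thesis
      using dom_mult[OF that(1,2)] dil_dil[OF that(1,2)] fibre_domD[OF that(2) h g]
      by (simp add: fibre_dom_def fibre_dil_def[of G \<delta> \<epsilon>] fibre_dil_def[of G \<delta> "\<epsilon> \<otimes> \<mu>"] eq)
  qed
  show ?thesis
    by (simp add: dilat_A1_def dom hom one act)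
qed

section \<open>Contraction to the base point and joint continuity\<close>

lemma fibre_dil_vanishing:
  assumes S: "Metric_space.mbounded (fibre G x) (fibre_dist G d x) S"
  shows "unif_vanishing \<Gamma> nu (\<lambda>\<epsilon>. {(h, g). h \<in> S \<and> g \<in> S \<and> g \<in> fibre_dom G dm x \<epsilon> h})
     (\<lambda>\<epsilon> (h, g). fibre_dist G d x (fibre_dil G \<delta> \<epsilon> h g) h)"
proof -
  obtain b where "0 < b" and S: "S \<subseteq> fibre G x" and b: "\<And>g h. \<lbrakk>g \<in> S; h \<in> S\<rbrakk> \<Longrightarrow> d (gdif G g h) \<le> b"
    using mbounded_fibre_norm_dif[OF S] by blast
  show ?thesis
    unfolding unif_vanishing_def
  proof (intro allI impI)
    fix \<eta> :: real assume "0 < \<eta>"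
    obtain r where r: "0 < r" "\<And>\<epsilon> g. \<lbrakk>\<epsilon> \<in> carrier \<Gamma>; nu \<epsilon> \<le> r; g \<in> dm \<epsilon>; d g \<le> b\<rbrakk> \<Longrightarrow> d (\<delta> \<epsilon> g) \<le> \<eta>"
      by (rule dil_vanishing[OF \<open>0 < b\<close> \<open>0 < \<eta>\<close>]) (rule that)
    have "fibre_dist G d x (fibre_dil G \<delta> \<epsilon> h g) h \<le> \<eta>"
      if "\<epsilon> \<in> carrier \<Gamma>" "nu \<epsilon> \<le> r" "h \<in> S" "g \<in> S" "g \<in> fibre_dom G dm x \<epsilon> h" for \<epsilon> h g
      using that S b[of g h] r(2)[OF that(1,2)]
      by (auto simp: fibre_dist_fibre_dil_base fibre_dom_def)
    then show "\<exists>r>0. \<forall>\<epsilon>\<in>carrier \<Gamma>. nu \<epsilon> \<le> r \<longrightarrow>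
        (\<forall>a\<in>{(h, g). h \<in> S \<and> g \<in> S \<and> g \<in> fibre_dom G dm x \<epsilon> h}.
          (case a of (h, g) \<Rightarrow> fibre_dist G d x (fibre_dil G \<delta> \<epsilon> h g) h) \<le> \<eta>)"
      using r(1) by (intro exI[of _ r]) auto
  qed
qed

lemma dilat_A2_fibre:
  "dilat_A2 \<Gamma> nu (fibre G x) (fibre_dist G d x) (fibre_dom G dm x) (fibre_dil G \<delta>)"
proof -
  interpret Metric_space "fibre G x" "fibre_dist G d x"
    by (rule Metric_space_fibre)
  let ?D = "{(t, h, g). case t of None \<Rightarrow> True | Some \<epsilon> \<Rightarrow> g \<in> fibre_dom G dm x \<epsilon> h}"
  let ?P = "prod_topology (scale_topology \<Gamma> nu) (prod_topology mtopology mtopology)"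
  let ?f = "\<lambda>(t, h, g). case t of None \<Rightarrow> h | Some \<epsilon> \<Rightarrow> fibre_dil G \<delta> \<epsilon> h g"
  have top: "topspace (scale_topology \<Gamma> nu) \<subseteq> insert None (Some ` carrier \<Gamma>)"
    by (metis openin_scale_topology openin_topspace)
  have "continuous_map (subtopology ?P ?D) mtopology ?f"
    unfolding continuous_map_to_metric
  proof (intro ballI allI impI)
    fix z and \<eta> :: real assume z: "z \<in> topspace (subtopology ?P ?D)" and "0 < \<eta>"
    obtain t h g where zt: "z = (t, h, g)" by (metis prod_cases3)
    have h: "h \<in> fibre G x" and g: "g \<in> fibre G x" and t: "t \<in> insert None (Some ` carrier \<Gamma>)"
      and D: "(t, h, g) \<in> ?D"
      using z top by (auto simp: zt)
    \<comment> \<open>A box neighbourhood is found separately at scale 0 and at a proper scale. At 0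
      the uniform contraction decides; at \<open>Some \<epsilon>\<close> the scale can be held fixed
      and continuity in the two points decides.\<close>
    have "\<exists>V W. openin (scale_topology \<Gamma> nu) V \<and> openin (prod_topology mtopology mtopology) W \<and>
        t \<in> V \<and> (h, g) \<in> W \<and> (\<forall>y \<in> (V \<times> W) \<inter> ?D. ?f y \<in> mball (?f z) \<eta>)"
    proof (cases t)
      case None
      \<comment> \<open>This bounds the distance of any two points taken from the unit balls around
        \<open>g\<close> and \<open>h\<close>, so that a single threshold \<open>r\<close> serves
        the whole neighbourhood.\<close>
      define b where "b = fibre_dist G d x g h + 2"
      have "0 < b" by (simp add: b_def add_nonneg_pos)
      then obtain r where r: "0 < r"
        "\<And>\<epsilon> g. \<lbrakk>\<epsilon> \<in> carrier \<Gamma>; nu \<epsilon> \<le> r; g \<in> dm \<epsilon>; d g \<le> b\<rbrakk> \<Longrightarrow> d (\<delta> \<epsilon> g) \<le> \<eta> / 2"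
        using dil_vanishing[OF \<open>0 < b\<close>, of "\<eta> / 2"] \<open>0 < \<eta>\<close> by auto
      let ?V = "insert None (Some ` {\<epsilon> \<in> carrier \<Gamma>. nu \<epsilon> < r})"
      \<comment> \<open>Radius 1 keeps differences below \<open>b\<close>; \<open>\<eta> / 2\<close>
        bounds the move of the base point and leaves the other half of \<open>\<eta>\<close> for the
        dilatation.\<close>
      let ?W = "mball h (min 1 (\<eta> / 2)) \<times> mball g 1"
      have V: "openin (scale_topology \<Gamma> nu) ?V"
        unfolding openin_scale_topology using r(1) by blast
      have "?f y \<in> mball h \<eta>" if y: "y \<in> (?V \<times> ?W) \<inter> ?D" for y
      proof -
        obtain s h' g' where yt: "y = (s, h', g')" by (metis prod_cases3)
        have h': "h' \<in> fibre G x" "fibre_dist G d x h h' < 1" "fibre_dist G d x h h' < \<eta> / 2"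
          and g': "g' \<in> fibre G x" "fibre_dist G d x g g' < 1"
          using y by (auto simp: yt)
        show ?thesis
        proof (cases s)
          case None
          then show ?thesis using h h' \<open>0 < \<eta>\<close> by (simp add: yt)
        next
          case (Some \<epsilon>)
          then have \<epsilon>: "\<epsilon> \<in> carrier \<Gamma>" "nu \<epsilon> \<le> r" and gd: "g' \<in> fibre_dom G dm x \<epsilon> h'"
            using y by (auto simp: yt)
          have "fibre_dist G d x g' h' \<le> b"
            using triangle[of g' g h'] triangle[of g h h'] h g h' g' commute[of g g']
            by (simp add: b_def)
          then have "d (\<delta> \<epsilon> (gdif G g' h')) \<le> \<eta> / 2"
            using r(2)[OF \<epsilon>] fibre_domD[OF \<epsilon>(1) h'(1) gd] g' h' by (simp add: fibre_dist_eq)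
          then have "fibre_dist G d x (fibre_dil G \<delta> \<epsilon> h' g') h' \<le> \<eta> / 2"
            using \<epsilon> h' gd by (simp add: fibre_dist_fibre_dil_base)
          moreover have k: "fibre_dil G \<delta> \<epsilon> h' g' \<in> fibre G x"
            using \<epsilon> h' gd by (simp add: fibre_dil_in_fibre)
          ultimately have "fibre_dist G d x h (fibre_dil G \<delta> \<epsilon> h' g') < \<eta>"
            using triangle[OF h h'(1) k] h'(3) commute[of h' "fibre_dil G \<delta> \<epsilon> h' g'"] by simp
          then show ?thesis using h k by (simp add: yt Some)
        qed
      qed
      then show ?thesis
        using V None h g \<open>0 < \<eta>\<close> zt
        by (intro exI[of _ ?V] exI[of _ ?W]) (auto simp: openin_prod_Times_iff)
    next
      case (Some \<epsilon>)
      then have \<epsilon>: "\<epsilon> \<in> carrier \<Gamma>" and gd: "g \<in> fibre_dom G dm x \<epsilon> h"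
        using t D by auto
      obtain \<kappa> where \<kappa>: "0 < \<kappa>" "\<And>h' g'. \<lbrakk>h' \<in> fibre G x; g' \<in> fibre_dom G dm x \<epsilon> h';
           fibre_dist G d x h h' \<le> \<kappa>; fibre_dist G d x g g' \<le> \<kappa>\<rbrakk>
         \<Longrightarrow> fibre_dist G d x (fibre_dil G \<delta> \<epsilon> h g) (fibre_dil G \<delta> \<epsilon> h' g') \<le> \<eta> / 2"
        using fibre_dil_continuous[OF \<epsilon> h gd, of "\<eta> / 2"] \<open>0 < \<eta>\<close> by auto
      let ?W = "mball h \<kappa> \<times> mball g \<kappa>"
      \<comment> \<open>Sets not containing \<open>None\<close> carry no further condition, so the
        singleton is open.\<close>
      have V: "openin (scale_topology \<Gamma> nu) {Some \<epsilon>}"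
        using \<epsilon> by (simp add: openin_scale_topology)
      have "?f y \<in> mball (fibre_dil G \<delta> \<epsilon> h g) \<eta>" if y: "y \<in> ({Some \<epsilon>} \<times> ?W) \<inter> ?D" for y
      proof -
        obtain h' g' where yt: "y = (Some \<epsilon>, h', g')" using y by auto
        then have h': "h' \<in> fibre G x" "g' \<in> fibre_dom G dm x \<epsilon> h'"
          and "fibre_dist G d x h h' \<le> \<kappa>" "fibre_dist G d x g g' \<le> \<kappa>"
          using y by auto
        then have "fibre_dist G d x (fibre_dil G \<delta> \<epsilon> h g) (fibre_dil G \<delta> \<epsilon> h' g') < \<eta>"
          using \<kappa>(2)[of h' g'] \<open>0 < \<eta>\<close> by linarith
        then show ?thesis
          using fibre_dil_in_fibre[OF \<epsilon> h gd] fibre_dil_in_fibre[OF \<epsilon> h'] by (simp add: yt)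
      qed
      then show ?thesis
        using V Some h g \<kappa>(1) zt
        by (intro exI[of _ "{Some \<epsilon>}"] exI[of _ ?W]) (auto simp: openin_prod_Times_iff)
    qed
    then obtain V W where "openin (scale_topology \<Gamma> nu) V" "openin (prod_topology mtopology mtopology) W"
      "t \<in> V" "(h, g) \<in> W" and *: "\<And>y. y \<in> (V \<times> W) \<inter> ?D \<Longrightarrow> ?f y \<in> mball (?f z) \<eta>"
      by blast
    then have "openin (subtopology ?P ?D) ((V \<times> W) \<inter> ?D)" "z \<in> (V \<times> W) \<inter> ?D"
      using D by (auto simp: zt openin_prod_Times_iff intro!: openin_subtopology_Int)
    with * show "\<exists>V. openin (subtopology ?P ?D) V \<and> z \<in> V \<and> (\<forall>y\<in>V. ?f y \<in> mball (?f z) \<eta>)"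
      by blast
  qed
  then show ?thesis
    unfolding dilat_A2_def using fibre_dil_vanishing by blast
qed

end

section \<open>The metric limits\<close>

text \<open>The hypothesis places a \<open>\<rho>\<close>-entourage inside every
  \<open>\<sigma>\<close>-entourage, and smaller filters are those generated by smaller
  sets.\<close>

lemma dist_uniformity_le:
  assumes "\<And>e. 0 < e \<Longrightarrow> \<exists>e'>0. \<forall>u\<in>Y. \<forall>v\<in>Y. \<rho> u v < e' \<longrightarrow> \<sigma> u v < e"
  shows "dist_uniformity Y \<rho> \<le> dist_uniformity Y \<sigma>"
  unfolding dist_uniformity_def
proof (rule INF_mono)
  fix e :: real assume "e \<in> {0<..}"
  then obtain e' where "0 < e'" "\<forall>u\<in>Y. \<forall>v\<in>Y. \<rho> u v < e' \<longrightarrow> \<sigma> u v < e"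
    using assms by (metis greaterThan_iff)
  then show "\<exists>e'\<in>{0<..}. principal {(u, v). u \<in> Y \<and> v \<in> Y \<and> \<rho> u v < e'}
      \<le> principal {(u, v). u \<in> Y \<and> v \<in> Y \<and> \<sigma> u v < e}"
    by (intro bexI[of _ e']) auto
qed

text \<open>The assumption on all filters is tested on the largest filter that lives on
  \<open>D\<close> and along which \<open>f\<close> tends to 0. Being generated by the sets
  \<open>\<bar>f a\<bar> < e'\<close> within \<open>D\<close>, it turns convergence into an
  epsilon-delta statement.\<close>

lemma small_if_tendsto_0_imp:
  fixes f g :: "'a \<Rightarrow> real"
  assumes "\<And>F. \<lbrakk>\<forall>\<^sub>F a in F. a \<in> D; (f \<longlongrightarrow> 0) F\<rbrakk> \<Longrightarrow> (g \<longlongrightarrow> 0) F" and "0 < e"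
  obtains e' where "0 < e'" "\<And>a. \<lbrakk>a \<in> D; \<bar>f a\<bar> < e'\<rbrakk> \<Longrightarrow> \<bar>g a\<bar> < e"
proof -
  let ?F = "inf (filtercomap f (nhds 0)) (principal D)"
  have "(f \<longlongrightarrow> 0) ?F"
    by (meson filterlim_filtercomap filterlim_mono inf_le1 order_refl)
  moreover have "\<forall>\<^sub>F a in ?F. a \<in> D"
    by (simp add: eventually_inf_principal)
  ultimately have "\<forall>\<^sub>F a in ?F. \<bar>g a\<bar> < e"
    using assms tendstoD[of g 0 ?F e] by (simp add: dist_real_def)
  then obtain Q where "eventually Q (nhds 0)" and Q: "\<And>a. \<lbrakk>Q (f a); a \<in> D\<rbrakk> \<Longrightarrow> \<bar>g a\<bar> < e"
    by (auto simp: eventually_inf_principal eventually_filtercomap)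
  then show thesis
    using that unfolding eventually_nhds_metric by (auto simp: dist_real_def)
qed

section \<open>Limits on the double groupoid\<close>

locale weak_delta_groupoid = deformed_groupoid +
  fixes U :: "'c set" and d0 :: "'c \<times> 'c \<Rightarrow> real"
  assumes A3: "weak_A3 \<Gamma> nu G d dm \<delta> U d0" and A4: "weak_A4 \<Gamma> nu G d dm \<delta> U d0"
begin

text \<open>A4weak makes \<open>d0\<close> the norm of a deformed groupoid. This removes the
  absolute values when \<open>d0\<close> is compared with the distance.\<close>

lemma double_norm_nonneg: "a \<in> arrows (double_groupoid G U) \<Longrightarrow> 0 \<le> d0 a"
  using A4 by (auto simp: weak_A4_def deformation_def sep_normed_groupoid_def groupoid_norm_def)

text \<open>One pair \<open>dmb\<close>, \<open>\<delta>b\<close> is fixed for all parameters, and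
  the domain condition and the error estimate of A4weak are put under a common threshold.\<close>

lemma induced_limit:
  obtains dmb \<delta>b where "deformation \<Gamma> nu (double_groupoid G U) d0 dmb \<delta>b"
    and "\<And>\<epsilon> b \<eta>. \<lbrakk>\<epsilon> \<in> carrier \<Gamma>; 0 < b; 0 < \<eta>\<rbrakk> \<Longrightarrow> \<exists>r>0. \<forall>\<mu>\<in>carrier \<Gamma>. nu \<mu> \<le> r \<longrightarrow>
      (\<forall>a\<in>induced_dom \<Gamma> G dm \<delta> \<mu> \<epsilon>. d (fst a) \<le> b \<longrightarrow> d (snd a) \<le> b \<longrightarrow>
        a \<in> dmb \<epsilon> \<and> d (gdif G (induced_map \<Gamma> G \<delta> \<mu> \<epsilon> a) (fst (\<delta>b \<epsilon> a))) \<le> \<eta>)"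
proof -
  obtain dmb \<delta>b where def: "deformation \<Gamma> nu (double_groupoid G U) d0 dmb \<delta>b"
    and lim: "\<forall>\<epsilon>\<in>carrier \<Gamma>. \<forall>b>0.
      (\<exists>r>0. \<forall>\<mu>\<in>carrier \<Gamma>. nu \<mu> \<le> r \<longrightarrow>
         (\<forall>(g, h)\<in>induced_dom \<Gamma> G dm \<delta> \<mu> \<epsilon>. d g \<le> b \<and> d h \<le> b \<longrightarrow> (g, h) \<in> dmb \<epsilon>)) \<and>
      unif_vanishing \<Gamma> nu (\<lambda>\<mu>. {(g, h) \<in> induced_dom \<Gamma> G dm \<delta> \<mu> \<epsilon>. d g \<le> b \<and> d h \<le> b})
        (\<lambda>\<mu> a. d (gdif G (induced_map \<Gamma> G \<delta> \<mu> \<epsilon> a) (fst (\<delta>b \<epsilon> a))))"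
    using A4 unfolding weak_A4_def by (elim exE conjE) (rule that)
  show thesis
  proof (rule that[OF def])
    fix \<epsilon> and b \<eta> :: real
    assume "\<epsilon> \<in> carrier \<Gamma>" "0 < b" "0 < \<eta>"
    note l = lim[rule_format, OF this(1,2)]
    obtain r where "0 < r" and r: "\<forall>\<mu>\<in>carrier \<Gamma>. nu \<mu> \<le> r \<longrightarrow>
        (\<forall>(g, h)\<in>induced_dom \<Gamma> G dm \<delta> \<mu> \<epsilon>. d g \<le> b \<and> d h \<le> b \<longrightarrow> (g, h) \<in> dmb \<epsilon>)"
      using conjunct1[OF l] by (elim exE conjE) (rule that)
    obtain s where "0 < s" and s: "\<And>\<mu> a. \<lbrakk>\<mu> \<in> carrier \<Gamma>; nu \<mu> \<le> s;
        a \<in> {(g, h) \<in> induced_dom \<Gamma> G dm \<delta> \<mu> \<epsilon>. d g \<le> b \<and> d h \<le> b}\<rbrakk> \<Longrightarrow>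
        d (gdif G (induced_map \<Gamma> G \<delta> \<mu> \<epsilon> a) (fst (\<delta>b \<epsilon> a))) \<le> \<eta>"
      using conjunct2[OF l] \<open>0 < \<eta>\<close> by (rule unif_vanishingE) (rule that)
    show "\<exists>r>0. \<forall>\<mu>\<in>carrier \<Gamma>. nu \<mu> \<le> r \<longrightarrow>
      (\<forall>a\<in>induced_dom \<Gamma> G dm \<delta> \<mu> \<epsilon>. d (fst a) \<le> b \<longrightarrow> d (snd a) \<le> b \<longrightarrow>
        a \<in> dmb \<epsilon> \<and> d (gdif G (induced_map \<Gamma> G \<delta> \<mu> \<epsilon> a) (fst (\<delta>b \<epsilon> a))) \<le> \<eta>)"
    proof (intro exI[of _ "min r s"] conjI ballI impI)
      show "0 < min r s"
        using \<open>0 < r\<close> \<open>0 < s\<close> by simp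
      fix \<mu> a assume \<mu>: "\<mu> \<in> carrier \<Gamma>" and \<mu>_le: "nu \<mu> \<le> min r s"
        and a: "a \<in> induced_dom \<Gamma> G dm \<delta> \<mu> \<epsilon>" "d (fst a) \<le> b" "d (snd a) \<le> b"
      have "nu \<mu> \<le> r"
        using \<mu>_le by simp
      then show "a \<in> dmb \<epsilon>"
        using bspec[OF mp[OF bspec[OF r \<mu>]] a(1)] a by (simp add: case_prod_unfold)
      show "d (gdif G (induced_map \<Gamma> G \<delta> \<mu> \<epsilon> a) (fst (\<delta>b \<epsilon> a))) \<le> \<eta>"
        by (rule s[OF \<mu>]) (use \<mu>_le a in \<open>simp_all add: case_prod_unfold\<close>)
    qed
  qed
qed

lemma dom_subset_nbhd:
  assumes "0 < b"
  obtains r where "0 < r" "\<And>\<mu> g. \<lbrakk>\<mu> \<in> carrier \<Gamma>; nu \<mu> \<le> r; g \<in> dm \<mu>; d g \<le> b\<rbrakk> \<Longrightarrow> g \<in> U"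
proof -
  obtain dmb \<delta>b where def: "deformation \<Gamma> nu (double_groupoid G U) d0 dmb \<delta>b"
    and lim: "\<And>\<epsilon> b \<eta>. \<lbrakk>\<epsilon> \<in> carrier \<Gamma>; 0 < b; 0 < \<eta>\<rbrakk> \<Longrightarrow> \<exists>r>0. \<forall>\<mu>\<in>carrier \<Gamma>. nu \<mu> \<le> r \<longrightarrow>
      (\<forall>a\<in>induced_dom \<Gamma> G dm \<delta> \<mu> \<epsilon>. d (fst a) \<le> b \<longrightarrow> d (snd a) \<le> b \<longrightarrow>
        a \<in> dmb \<epsilon> \<and> d (gdif G (induced_map \<Gamma> G \<delta> \<mu> \<epsilon> a) (fst (\<delta>b \<epsilon> a))) \<le> \<eta>)"
    by (rule induced_limit) (rule that)
  \<comment> \<open>The limit is taken at the neutral scale, where the diagonal is easily seen to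
    lie in the induced domains. The tolerance 1 is arbitrary: the domain half of the limit is what
    is kept.\<close>
  obtain r where "0 < r" and r: "\<And>\<mu> g. \<lbrakk>\<mu> \<in> carrier \<Gamma>; nu \<mu> \<le> r;
      (g, g) \<in> induced_dom \<Gamma> G dm \<delta> \<mu> \<one>; d g \<le> b\<rbrakk> \<Longrightarrow> (g, g) \<in> dmb \<one>"
    using lim[OF scale.one_closed assms zero_less_one] by fastforce
  have sub: "dmb \<one> \<subseteq> U \<times> U"
    using def by (auto simp: deformation_def double_groupoid_def)
  \<comment> \<open>The difference of \<open>\<delta> \<mu> g\<close> with itself is an object,
    hence fixed by \<open>\<delta> \<one>\<close>. The product is then
    \<open>\<delta> \<mu> g\<close>, which lies in the domain of the inverse scale.\<close>
  have "(g, g) \<in> induced_dom \<Gamma> G dm \<delta> \<mu> \<one>" if "\<mu> \<in> carrier \<Gamma>" "g \<in> dm \<mu>" for \<mu> g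
  proof -
    have "gtgt G (\<delta> \<mu> g) \<in> objects G"
      using that by (simp add: dil_closed tgt_in_objects)
    then show ?thesis
      using that objects_dom[of \<one>]
      by (auto simp: induced_dom_def dif_self dil_object tgt_mult_self dil_closed dil_in_dom)
  qed
  then show thesis
    using that[OF \<open>0 < r\<close>] r sub by blast
qed

lemma dilat_A3_fibre:
  "dilat_A3 \<Gamma> nu (fibre G x) (fibre_dist G d x) (fibre_dom G dm x) (fibre_dil G \<delta>)"
proof -
  interpret Metric_space "fibre G x" "fibre_dist G d x"
    by (rule Metric_space_fibre)
  \<comment> \<open>The limit distance at \<open>h\<close> is \<open>d0\<close> translated to
    \<open>h\<close>. Where \<open>d0\<close> has no prescribed meaning, the distance itself is the
    default, since a constant would spoil the equality of uniformities.\<close>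
  define dx where "dx h u v =
    (if gdif G u h \<in> U \<and> gdif G v h \<in> U then d0 (gdif G u h, gdif G v h) else fibre_dist G d x u v)"
    for h u v
  have pair: "(gdif G u h, gdif G v h) \<in> arrows (double_groupoid G U)"
    if "h \<in> fibre G x" "u \<in> fibre G x" "v \<in> fibre G x" "gdif G u h \<in> U" "gdif G v h \<in> U" for h u v
    using that by (auto simp: double_groupoid_def fibreD src_dif)
  \<comment> \<open>The radius is \<open>A = 2\<close>. It bounds all differences by 2 whatever the
    base point is, so the convergence is uniform over an arbitrary \<open>S\<close>.\<close>
  have lim: "unif_vanishing \<Gamma> nu
      (\<lambda>\<epsilon>. {(h, u, v). h \<in> S \<and> u \<in> mcball h 2 \<and> v \<in> mcball h 2 \<and>
                u \<in> fibre_dom G dm x \<epsilon> h \<and> v \<in> fibre_dom G dm x \<epsilon> h})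
      (\<lambda>\<epsilon> (h, u, v). \<bar>1 / nu \<epsilon> * fibre_dist G d x (fibre_dil G \<delta> \<epsilon> h u) (fibre_dil G \<delta> \<epsilon> h v) - dx h u v\<bar>)"
    for S
    unfolding unif_vanishing_def
  proof (intro allI impI)
    fix \<eta> :: real assume "0 < \<eta>"
    have "unif_vanishing \<Gamma> nu
        (\<lambda>\<epsilon>. {(g, h) \<in> arrows (double_groupoid G U). g \<in> dm \<epsilon> \<and> h \<in> dm \<epsilon> \<and> d g \<le> 2 \<and> d h \<le> 2})
        (\<lambda>\<epsilon> (g, h). \<bar>1 / nu \<epsilon> * d (gdif G (\<delta> \<epsilon> g) (\<delta> \<epsilon> h)) - d0 (g, h)\<bar>)"
      using A3 by (simp add: weak_A3_def)
    note lim = mp[OF spec[OF this[unfolded unif_vanishing_def]] \<open>0 < \<eta>\<close>]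
    obtain r where "0 < r" and r: "\<forall>\<epsilon>\<in>carrier \<Gamma>. nu \<epsilon> \<le> r \<longrightarrow>
        (\<forall>a\<in>{(g, h) \<in> arrows (double_groupoid G U). g \<in> dm \<epsilon> \<and> h \<in> dm \<epsilon> \<and> d g \<le> 2 \<and> d h \<le> 2}.
          (case a of (g, h) \<Rightarrow> \<bar>1 / nu \<epsilon> * d (gdif G (\<delta> \<epsilon> g) (\<delta> \<epsilon> h)) - d0 (g, h)\<bar>) \<le> \<eta>)"
      using lim by (elim exE conjE) (rule that)
    \<comment> \<open>Below this scale all differences in question lie in \<open>U\<close>, so that
      \<open>dx\<close> takes its value from \<open>d0\<close>.\<close>
    obtain s where "0 < s" and s: "\<And>\<epsilon> g. \<lbrakk>\<epsilon> \<in> carrier \<Gamma>; nu \<epsilon> \<le> s; g \<in> dm \<epsilon>; d g \<le> 2\<rbrakk> \<Longrightarrow> g \<in> U"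
      by (rule dom_subset_nbhd[of 2]) (simp, rule that)
    have "\<bar>1 / nu \<epsilon> * fibre_dist G d x (fibre_dil G \<delta> \<epsilon> h u) (fibre_dil G \<delta> \<epsilon> h v) - dx h u v\<bar> \<le> \<eta>"
      if \<epsilon>: "\<epsilon> \<in> carrier \<Gamma>" and "nu \<epsilon> \<le> min r s" and uv: "u \<in> mcball h 2" "v \<in> mcball h 2"
        and u: "u \<in> fibre_dom G dm x \<epsilon> h" and v: "v \<in> fibre_dom G dm x \<epsilon> h" for \<epsilon> h u v
    proof -
      have h: "h \<in> fibre G x" using uv by auto
      note uD = fibre_domD[OF \<epsilon> h u] and vD = fibre_domD[OF \<epsilon> h v]
      have "d (gdif G u h) \<le> 2" "d (gdif G v h) \<le> 2"
        using uv commute[of h] uD vD h by (auto simp: fibre_dist_eq)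
      moreover from this have "gdif G u h \<in> U" "gdif G v h \<in> U"
        using s[OF \<epsilon>] that(2) uD vD by auto
      moreover have "fibre_dist G d x (fibre_dil G \<delta> \<epsilon> h u) (fibre_dil G \<delta> \<epsilon> h v)
          = d (gdif G (\<delta> \<epsilon> (gdif G u h)) (\<delta> \<epsilon> (gdif G v h)))"
        unfolding fibre_dil_def using \<epsilon> h u v
        by (intro fibre_dist_mult_mult) (auto intro: dil_dif_closed src_dil_dif)
      ultimately show ?thesis
        using r[rule_format, OF \<epsilon>, of "(gdif G u h, gdif G v h)"] pair[of h u v] that(2) uD vD h
        by (simp add: dx_def)
    qed
    then show "\<exists>r>0. \<forall>\<epsilon>\<in>carrier \<Gamma>. nu \<epsilon> \<le> r \<longrightarrow>
      (\<forall>a\<in>{(h, u, v). h \<in> S \<and> u \<in> mcball h 2 \<and> v \<in> mcball h 2 \<and>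
                u \<in> fibre_dom G dm x \<epsilon> h \<and> v \<in> fibre_dom G dm x \<epsilon> h}.
        (case a of (h, u, v) \<Rightarrow> \<bar>1 / nu \<epsilon> * fibre_dist G d x (fibre_dil G \<delta> \<epsilon> h u)
          (fibre_dil G \<delta> \<epsilon> h v) - dx h u v\<bar>) \<le> \<eta>)"
      using \<open>0 < r\<close> \<open>0 < s\<close> by (intro exI[of _ "min r s"]) auto
  qed
  have conv: "(d0 \<longlongrightarrow> 0) F \<longleftrightarrow> ((\<lambda>(g, h). d (gdif G g h)) \<longlongrightarrow> 0) F"
    if "\<forall>\<^sub>F a in F. a \<in> arrows (double_groupoid G U)" for F
    using A3 that by (simp add: weak_A3_def)
  have eq: "d (gdif G (gdif G u h) (gdif G v h)) = fibre_dist G d x u v"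
    if "h \<in> fibre G x" "u \<in> fibre G x" "v \<in> fibre G x" for h u v
    using that by (simp add: fibre_dist_eq dif_dif fibreD)
  have "dist_uniformity (mcball h 2) (dx h) = dist_uniformity (mcball h 2) (fibre_dist G d x)"
    if h: "h \<in> fibre G x" for h
  proof (intro antisym dist_uniformity_le)
    fix e :: real assume "0 < e"
    obtain e' where "0 < e'" and e': "\<And>a. \<lbrakk>a \<in> arrows (double_groupoid G U); \<bar>d0 a\<bar> < e'\<rbrakk>
        \<Longrightarrow> \<bar>case a of (g, h) \<Rightarrow> d (gdif G g h)\<bar> < e"
      using small_if_tendsto_0_imp[of "arrows (double_groupoid G U)" d0, OF _ \<open>0 < e\<close>] conv by blast
    \<comment> \<open>The bound \<open>e'\<close> serves pairs of differences in \<open>U\<close>,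
      the bound \<open>e\<close> those where \<open>dx\<close> is the distance. The converse
      comparison below splits in the same way.\<close>
    have "fibre_dist G d x u v < e" if "u \<in> mcball h 2" "v \<in> mcball h 2" "dx h u v < min e e'" for u v
      using that e'[OF pair[of h u v]] double_norm_nonneg[OF pair[of h u v]] h eq[of h u v]
      by (auto simp: dx_def split: if_splits)
    then show "\<exists>e'>0. \<forall>u\<in>mcball h 2. \<forall>v\<in>mcball h 2. dx h u v < e' \<longrightarrow> fibre_dist G d x u v < e"
      using \<open>0 < e\<close> \<open>0 < e'\<close> by (intro exI[of _ "min e e'"]) auto
  next
    fix e :: real assume "0 < e"
    obtain e' where "0 < e'" and e': "\<And>a. \<lbrakk>a \<in> arrows (double_groupoid G U);
        \<bar>case a of (g, h) \<Rightarrow> d (gdif G g h)\<bar> < e'\<rbrakk> \<Longrightarrow> \<bar>d0 a\<bar> < e"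
      using small_if_tendsto_0_imp[of "arrows (double_groupoid G U)" "\<lambda>(g, h). d (gdif G g h)", OF _ \<open>0 < e\<close>]
        conv by blast
    have "dx h u v < e" if "u \<in> mcball h 2" "v \<in> mcball h 2" "fibre_dist G d x u v < min e e'" for u v
      using that e'[OF pair[of h u v]] h eq[of h u v]
      by (auto simp: dx_def split: if_splits)
    then show "\<exists>e'>0. \<forall>u\<in>mcball h 2. \<forall>v\<in>mcball h 2. fibre_dist G d x u v < e' \<longrightarrow> dx h u v < e"
      using \<open>0 < e\<close> \<open>0 < e'\<close> by (intro exI[of _ "min e e'"]) auto
  qed
  then show ?thesis
    unfolding dilat_A3_def using lim by (intro exI[of _ 2] conjI exI[of _ dx]) auto
qed

text \<open>After subtracting \<open>h\<close>, the iterated dilatation is the induced map at the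
  pair \<open>(v h^-1, u h^-1)\<close>: the inner base point \<open>u\<close> goes into the second
  component. Here \<open>\<epsilon>\<close> is the vanishing scale and \<open>\<mu>\<close> the
  fixed one.\<close>

lemma dilat_A4weak_fibre:
  "dilat_A4weak \<Gamma> nu (fibre G x) (fibre_dist G d x) (fibre_dom G dm x) (fibre_dil G \<delta>)"
proof -
  interpret Metric_space "fibre G x" "fibre_dist G d x"
    by (rule Metric_space_fibre)
  obtain dmb \<delta>b where def: "deformation \<Gamma> nu (double_groupoid G U) d0 dmb \<delta>b"
    and lim: "\<And>\<mu> b \<eta>. \<lbrakk>\<mu> \<in> carrier \<Gamma>; 0 < b; 0 < \<eta>\<rbrakk> \<Longrightarrow> \<exists>r>0. \<forall>\<epsilon>\<in>carrier \<Gamma>. nu \<epsilon> \<le> r \<longrightarrow>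
      (\<forall>a\<in>induced_dom \<Gamma> G dm \<delta> \<epsilon> \<mu>. d (fst a) \<le> b \<longrightarrow> d (snd a) \<le> b \<longrightarrow>
        a \<in> dmb \<mu> \<and> d (gdif G (induced_map \<Gamma> G \<delta> \<epsilon> \<mu> a) (fst (\<delta>b \<mu> a))) \<le> \<eta>)"
    by (rule induced_limit) (rule that)
  \<comment> \<open>The source of a pair is its second component doubled. As
    \<open>\<delta>b\<close> preserves it, the second component remains \<open>h\<close>, and the
    first has the same source as \<open>h\<close> because both form an arrow of the double
    groupoid.\<close>
  have fst_dil: "fst (\<delta>b \<mu> (g, h)) \<in> arrows G" "gsrc G (fst (\<delta>b \<mu> (g, h))) = gsrc G h"
    if "\<mu> \<in> carrier \<Gamma>" "(g, h) \<in> dmb \<mu>" for \<mu> g h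
  proof -
    have "\<delta>b \<mu> (g, h) \<in> arrows (double_groupoid G U)"
      "gsrc (double_groupoid G U) (\<delta>b \<mu> (g, h)) = gsrc (double_groupoid G U) (g, h)"
      using def that by (auto simp: deformation_def deform_A1_def)
    then show "fst (\<delta>b \<mu> (g, h)) \<in> arrows G" "gsrc G (fst (\<delta>b \<mu> (g, h))) = gsrc G h"
      by (cases "\<delta>b \<mu> (g, h)"; auto simp: double_groupoid_src; auto simp: double_groupoid_def)+
  qed
  show ?thesis
    unfolding dilat_A4weak_def
  proof
    fix \<mu> assume \<mu>: "\<mu> \<in> carrier \<Gamma>"
    \<comment> \<open>The limit on the double groupoid, translated back by \<open>h\<close>. The
      default \<open>u\<close> keeps the values in the fibre; at small scales the pairs considered
      lie in \<open>dmb \<mu>\<close>.\<close>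
    define D where "D h u v = (if (gdif G v h, gdif G u h) \<in> dmb \<mu>
      then gmult G (fst (\<delta>b \<mu> (gdif G v h, gdif G u h))) h else u)" for h u v
    have "D h u v \<in> fibre G x" if "h \<in> fibre G x" "u \<in> fibre G x" "v \<in> fibre G x" for h u v
      using that fst_dil[OF \<mu>] by (auto simp: D_def src_dif fibreD intro!: mult_in_fibre)
    moreover have "unif_vanishing \<Gamma> nu
        (\<lambda>\<epsilon>. {(h, u, v). h \<in> S \<and> u \<in> S \<and> v \<in> S \<and> u \<in> fibre_dom G dm x \<epsilon> h \<and> v \<in> fibre_dom G dm x \<epsilon> h \<and>
           fibre_dil G \<delta> \<epsilon> h v \<in> fibre_dom G dm x \<mu> (fibre_dil G \<delta> \<epsilon> h u) \<and>
           fibre_dil G \<delta> \<mu> (fibre_dil G \<delta> \<epsilon> h u) (fibre_dil G \<delta> \<epsilon> h v) \<in> fibre_dom G dm x (inv \<epsilon>) h})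
        (\<lambda>\<epsilon> (h, u, v). fibre_dist G d x (fibre_dil G \<delta> (inv \<epsilon>) h
           (fibre_dil G \<delta> \<mu> (fibre_dil G \<delta> \<epsilon> h u) (fibre_dil G \<delta> \<epsilon> h v))) (D h u v))"
      if S: "mbounded S" for S
      unfolding unif_vanishing_def
    proof (intro allI impI)
      fix \<eta> :: real assume "0 < \<eta>"
      obtain b where "0 < b" and Sf: "S \<subseteq> fibre G x"
        and b: "\<And>g h. \<lbrakk>g \<in> S; h \<in> S\<rbrakk> \<Longrightarrow> d (gdif G g h) \<le> b"
        using mbounded_fibre_norm_dif[OF S] by blast
      obtain r where "0 < r" and r: "\<forall>\<epsilon>\<in>carrier \<Gamma>. nu \<epsilon> \<le> r \<longrightarrow>
          (\<forall>a\<in>induced_dom \<Gamma> G dm \<delta> \<epsilon> \<mu>. d (fst a) \<le> b \<longrightarrow> d (snd a) \<le> b \<longrightarrow>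
            a \<in> dmb \<mu> \<and> d (gdif G (induced_map \<Gamma> G \<delta> \<epsilon> \<mu> a) (fst (\<delta>b \<mu> a))) \<le> \<eta>)"
        using lim[OF \<mu> \<open>0 < b\<close> \<open>0 < \<eta>\<close>] by (elim exE conjE) (rule that)
      have "fibre_dist G d x (fibre_dil G \<delta> (inv \<epsilon>) h
           (fibre_dil G \<delta> \<mu> (fibre_dil G \<delta> \<epsilon> h u) (fibre_dil G \<delta> \<epsilon> h v))) (D h u v) \<le> \<eta>"
        if \<epsilon>: "\<epsilon> \<in> carrier \<Gamma>" and le: "nu \<epsilon> \<le> r" and hS: "h \<in> S" and uS: "u \<in> S" and vS: "v \<in> S"
          and u: "u \<in> fibre_dom G dm x \<epsilon> h" and v: "v \<in> fibre_dom G dm x \<epsilon> h"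
          and v1: "fibre_dil G \<delta> \<epsilon> h v \<in> fibre_dom G dm x \<mu> (fibre_dil G \<delta> \<epsilon> h u)"
          and w: "fibre_dil G \<delta> \<mu> (fibre_dil G \<delta> \<epsilon> h u) (fibre_dil G \<delta> \<epsilon> h v) \<in> fibre_dom G dm x (inv \<epsilon>) h"
        for \<epsilon> h u v
      proof -
        have h: "h \<in> fibre G x" using hS Sf by auto
        define a where "a = gdif G u h"
        define c where "c = gdif G v h"
        have uD: "u \<in> fibre G x" "a \<in> dm \<epsilon>" and vD: "v \<in> fibre G x" "c \<in> dm \<epsilon>"
          using fibre_domD[OF \<epsilon> h u] fibre_domD[OF \<epsilon> h v] by (simp_all add: a_def c_def)
        have ac: "\<delta> \<epsilon> a \<in> arrows G" "\<delta> \<epsilon> c \<in> arrows G" "gsrc G (\<delta> \<epsilon> a) = gtgt G h" "gsrc G (\<delta> \<epsilon> c) = gtgt G h"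
          "gsrc G a = gtgt G h" "gsrc G c = gtgt G h"
          using \<epsilon> h u v uD vD
          by (simp_all add: a_def c_def dil_dif_closed src_dil_dif src_dif fibreD)
        have u1: "fibre_dil G \<delta> \<epsilon> h u \<in> fibre G x"
          using \<epsilon> h u by (rule fibre_dil_in_fibre)
        have dif1: "gdif G (fibre_dil G \<delta> \<epsilon> h v) (fibre_dil G \<delta> \<epsilon> h u) = gdif G (\<delta> \<epsilon> c) (\<delta> \<epsilon> a)"
          using ac h by (simp add: fibre_dil_def dif_mult_mult fibreD flip: a_def c_def)
        then have in1: "gdif G (\<delta> \<epsilon> c) (\<delta> \<epsilon> a) \<in> dm \<mu>"
          using fibre_domD(2)[OF \<mu> u1 v1] by simp
        define m where "m = \<delta> \<mu> (gdif G (\<delta> \<epsilon> c) (\<delta> \<epsilon> a))"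
        have m: "m \<in> arrows G" "gsrc G m = gtgt G (\<delta> \<epsilon> a)"
          using \<mu> in1 ac by (simp_all add: m_def dil_closed src_dil src_dif)
        have "fibre_dil G \<delta> \<mu> (fibre_dil G \<delta> \<epsilon> h u) (fibre_dil G \<delta> \<epsilon> h v) = gmult G m (gmult G (\<delta> \<epsilon> a) h)"
          unfolding fibre_dil_def[of G \<delta> \<mu>] dif1 by (simp add: m_def a_def fibre_dil_def)
        \<comment> \<open>Moving \<open>h\<close> to the right end exposes the arrow on which the
          outer dilatation based at \<open>h\<close> acts.\<close>
        also have "\<dots> = gmult G (gmult G m (\<delta> \<epsilon> a)) h"
          using m ac h by (simp add: mult_assoc fibreD)
        finally have dil2: "fibre_dil G \<delta> \<mu> (fibre_dil G \<delta> \<epsilon> h u) (fibre_dil G \<delta> \<epsilon> h v)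
            = gmult G (gmult G m (\<delta> \<epsilon> a)) h" .
        have ma: "gmult G m (\<delta> \<epsilon> a) \<in> arrows G" "gsrc G (gmult G m (\<delta> \<epsilon> a)) = gtgt G h"
          using m ac by (simp_all add: mult_closed src_mult)
        have dif2: "gdif G (gmult G (gmult G m (\<delta> \<epsilon> a)) h) h = gmult G m (\<delta> \<epsilon> a)"
          using ma h by (simp add: mult_dif_cancel fibreD)
        then have in2: "gmult G m (\<delta> \<epsilon> a) \<in> dm (inv \<epsilon>)"
          using fibre_domD(2)[OF scale.inv_closed[OF \<epsilon>] h w] by (simp add: dil2)
        have ind: "(c, a) \<in> induced_dom \<Gamma> G dm \<delta> \<epsilon> \<mu>"
          using uD vD ac in1 in2 by (simp add: induced_dom_def m_def)
        have map: "induced_map \<Gamma> G \<delta> \<epsilon> \<mu> (c, a) = \<delta> (inv \<epsilon>) (gmult G m (\<delta> \<epsilon> a))"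
          by (simp add: induced_map_def m_def)
        have n: "d c \<le> b" "d a \<le> b"
          using b hS uS vS by (auto simp: a_def c_def)
        have dmb: "(c, a) \<in> dmb \<mu>"
          and "d (gdif G (induced_map \<Gamma> G \<delta> \<epsilon> \<mu> (c, a)) (fst (\<delta>b \<mu> (c, a)))) \<le> \<eta>"
          using r[rule_format, OF \<epsilon> le ind] n by simp_all
        \<comment> \<open>Translation by \<open>h\<close> is an isometry, so the fibre distance is
          exactly the error estimated in A4weak.\<close>
        moreover have "fibre_dist G d x (gmult G (induced_map \<Gamma> G \<delta> \<epsilon> \<mu> (c, a)) h) (gmult G (fst (\<delta>b \<mu> (c, a))) h)
            = d (gdif G (induced_map \<Gamma> G \<delta> \<epsilon> \<mu> (c, a)) (fst (\<delta>b \<mu> (c, a))))"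
          using h fst_dil[OF \<mu> dmb] ac in2 ma \<epsilon>
          by (intro fibre_dist_mult_mult) (simp_all add: map dil_closed src_dil)
        ultimately show ?thesis
          unfolding dil2 fibre_dil_def[of G \<delta> "inv \<epsilon>"] dif2
          by (simp add: map D_def flip: a_def c_def)
      qed
      then show "\<exists>r>0. \<forall>\<epsilon>\<in>carrier \<Gamma>. nu \<epsilon> \<le> r \<longrightarrow>
        (\<forall>a\<in>{(h, u, v). h \<in> S \<and> u \<in> S \<and> v \<in> S \<and> u \<in> fibre_dom G dm x \<epsilon> h \<and> v \<in> fibre_dom G dm x \<epsilon> h \<and>
           fibre_dil G \<delta> \<epsilon> h v \<in> fibre_dom G dm x \<mu> (fibre_dil G \<delta> \<epsilon> h u) \<and>
           fibre_dil G \<delta> \<mu> (fibre_dil G \<delta> \<epsilon> h u) (fibre_dil G \<delta> \<epsilon> h v) \<in> fibre_dom G dm x (inv \<epsilon>) h}.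
         (case a of (h, u, v) \<Rightarrow> fibre_dist G d x (fibre_dil G \<delta> (inv \<epsilon>) h
           (fibre_dil G \<delta> \<mu> (fibre_dil G \<delta> \<epsilon> h u) (fibre_dil G \<delta> \<epsilon> h v))) (D h u v)) \<le> \<eta>)"
        using \<open>0 < r\<close> by (intro exI[of _ r]) auto
    qed
    ultimately show "\<exists>\<delta>b. (\<forall>h\<in>fibre G x. \<forall>u\<in>fibre G x. \<forall>v\<in>fibre G x. \<delta>b h u v \<in> fibre G x) \<and>
        (\<forall>S. mbounded S \<longrightarrow> unif_vanishing \<Gamma> nu
        (\<lambda>\<epsilon>. {(h, u, v). h \<in> S \<and> u \<in> S \<and> v \<in> S \<and> u \<in> fibre_dom G dm x \<epsilon> h \<and> v \<in> fibre_dom G dm x \<epsilon> h \<and>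
           fibre_dil G \<delta> \<epsilon> h v \<in> fibre_dom G dm x \<mu> (fibre_dil G \<delta> \<epsilon> h u) \<and>
           fibre_dil G \<delta> \<mu> (fibre_dil G \<delta> \<epsilon> h u) (fibre_dil G \<delta> \<epsilon> h v) \<in> fibre_dom G dm x (inv \<epsilon>) h})
        (\<lambda>\<epsilon> (h, u, v). fibre_dist G d x (fibre_dil G \<delta> (inv \<epsilon>) h
           (fibre_dil G \<delta> \<mu> (fibre_dil G \<delta> \<epsilon> h u) (fibre_dil G \<delta> \<epsilon> h v))) (\<delta>b h u v)))"
      by (intro exI[of _ D]) blast
  qed
qed

end

theorem theorem5p3:
  fixes \<Gamma> :: "('s, 'm) monoid_scheme" and nu :: "'s \<Rightarrow> real"
    and G :: "'g grpd" and d :: "'g \<Rightarrow> real"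
    and dm :: "'s \<Rightarrow> 'g set" and \<delta> :: "'s \<Rightarrow> 'g \<Rightarrow> 'g" and x :: 'g
  assumes "scale_group \<Gamma> nu"
    and "weak_delta_structure \<Gamma> nu G d dm \<delta>"
    and "x \<in> objects G"
  shows "dilatation_structure \<Gamma> nu (fibre G x) (fibre_dist G d x)
           (fibre_dom G dm x) (fibre_dil G \<delta>)"
proof -
  obtain U d0 where def: "deformation \<Gamma> nu G d dm \<delta>"
    and A: "weak_A3 \<Gamma> nu G d dm \<delta> U d0" "weak_A4 \<Gamma> nu G d dm \<delta> U d0"
    using assms(2) by (auto simp: weak_delta_structure_def)
  interpret scale: scale_group \<Gamma> nu by fact
  interpret groupoid G
    using def by (simp add: deformation_def sep_normed_groupoid_def)
  interpret weak_delta_groupoid \<Gamma> nu G d dm \<delta> U d0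
    by unfold_locales (use def A in \<open>simp_all add: deformation_def sep_normed_groupoid_def\<close>)
  show ?thesis
    unfolding dilatation_structure_def
    using Metric_space_fibre dilat_A1_fibre dilat_A2_fibre dilat_A3_fibre dilat_A4weak_fibre by blast
qed

end
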